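(* Let Assumption A hold. Then $w(\lambda\pm i0)\ne0$ for all $\lambda>0$, and for each $\lambda>0$ the regular solution satisfies \[ \varphi(x,\lambda)=\frac{\kappa(\lambda)}{\sqrt{p_0\lambda}\,K(\lambda)}\sin\big(\Phi(x,\lambda)-\eta(\lambda)\big)+O(\varepsilon(x)),\qquad x\to\infty . \] In particular, the operator $H$ has no positive eigenvalues.
   Context: Assumption A: $p>0$ absolutely continuous on $\mathbb R_+$, $p'\in L^1(\mathbb R_+)$, $p(x)\to p_0>0$; $q$ real, $q\in L^1(0,x_0)$, absolutely continuous on $[x_0,\infty)$, $q'\in L^1(x_0,\infty)$, $q(x)\to0$. $\varepsilon(x)=\int_x^\infty(|p'|+|q'|)dy$; $(A)_+=(|A|+A)/2$; $\Phi(x,\lambda)=\int_0^x\sqrt{((\lambda-q)/p)_+}\,dy$, $K(\lambda)=\exp(-\int_0^\infty\sqrt{((q-\lambda)/p)_+}\,dy)$. Modified Jost solution $\theta(x,z)$ ($z\in\mathbb C\setminus\mathbb R$ or $z=\lambda\pm i0$, $\lambda\ne0$): with $\omega=\sqrt{(q-z)/p}$ ($\Re\omega>0$, boundary values on the cut) and $a(x,z)=\exp(-\int_0^x\omega\,dy)$, $\theta$ is the solution of $-(p\theta')'+q\theta=z\theta$ with $\theta(x,z)=a(x,z)(1+O(\varepsilon(x)))$ as $x\to\infty$ (constructed as $a u$, $u$ the bounded solution of $u(x)=1+\int_x^\infty a(y)^2\big(\int_x^yp^{-1}a^{-2}ds\big)(p\omega)'(y)u(y)dy$). The regular solution $\varphi(x,z)$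 solves $-(p\varphi')'+q\varphi=z\varphi$ with $\varphi(0,z)=0$, $\varphi'(0,z)=1$. The Wronskian $w(z)=p(x)(\varphi'\theta-\varphi\theta')=p(0)\theta(0,z)$. For $\lambda>0$: $\kappa(\lambda)=|w(\lambda\pm i0)|$ and $\eta(\lambda)$ is a continuous function with $w(\lambda+i0)=\kappa(\lambda)e^{i\eta(\lambda)}$. $H$ is the self-adjoint operator $-\frac{d}{dx}p\frac{d}{dx}+q$ in $L^2(\mathbb R_+)$ with boundary condition $f(0)=0$ (defined via the closed quadratic form $\int_0^\infty(p|f'|^2+q|f|^2)dx$ on $H^1_0(\mathbb R_+)$). *)

theory Defs
  imports "HOL-Analysis.Analysis"
begin

definition pos_part :: "real \<Rightarrow> real" where
  "pos_part A = (\<bar>A\<bar> + A) / 2"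

text \<open>Assumption A.  The absolutely continuous functions p (on [0,\<infinity>)) and q (on [x0,\<infinity>))
  are given as indefinite integrals of their derivatives p', q'.\<close>
definition assumption_A ::
  "(real \<Rightarrow> real) \<Rightarrow> (real \<Rightarrow> real) \<Rightarrow> real \<Rightarrow> (real \<Rightarrow> real) \<Rightarrow> (real \<Rightarrow> real) \<Rightarrow> real \<Rightarrow> bool" where
  "assumption_A p p' p0 q q' x0 \<longleftrightarrow>
     (\<forall>x\<ge>0. p x > 0) \<and>
     set_integrable lborel {0..} p' \<and>
     (\<forall>x\<ge>0. p x = p 0 + (LINT y:{0..x}|lborel. p' y)) \<and>
     (p \<longlongrightarrow> p0) at_top \<and> p0 > 0 \<and>
     x0 \<ge> 0 \<and>
     set_integrable lborel {0..x0} q \<and>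
     set_integrable lborel {x0..} q' \<and>
     (\<forall>x\<ge>x0. q x = q x0 + (LINT y:{x0..x}|lborel. q' y)) \<and>
     (q \<longlongrightarrow> 0) at_top"

text \<open>epsilon(x) = \<integral>_x^\<infinity> (|p'| + |q'|) dy  (q' is only given on [x0,\<infinity>)).\<close>
definition eps_fun :: "(real \<Rightarrow> real) \<Rightarrow> (real \<Rightarrow> real) \<Rightarrow> real \<Rightarrow> real \<Rightarrow> real" where
  "eps_fun p' q' x0 x = (LINT y:{x..}|lborel. \<bar>p' y\<bar> + indicator {x0..} y * \<bar>q' y\<bar>)"

text \<open>Solutions of -(p f')' + q f = z f on [0,\<infinity>) in the Caratheodory sense:
  f and the quasi-derivative g = p f' are absolutely continuous, f' = g/p and g' = (q - z) f.\<close>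
definition ode_solution ::
  "(real \<Rightarrow> real) \<Rightarrow> (real \<Rightarrow> real) \<Rightarrow> complex \<Rightarrow> (real \<Rightarrow> complex) \<Rightarrow> bool" where
  "ode_solution p q z f \<longleftrightarrow> (\<exists>g. \<forall>x\<ge>0.
     set_integrable lborel {0..x} (\<lambda>t. g t / complex_of_real (p t)) \<and>
     set_integrable lborel {0..x} (\<lambda>t. (complex_of_real (q t) - z) * f t) \<and>
     f x = f 0 + (LINT t:{0..x}|lborel. g t / complex_of_real (p t)) \<and>
     g x = g 0 + (LINT t:{0..x}|lborel. (complex_of_real (q t) - z) * f t))"

definition regular_solution ::
  "(real \<Rightarrow> real) \<Rightarrow> (real \<Rightarrow> real) \<Rightarrow> complex \<Rightarrow> real \<Rightarrow> complex" where
  "regular_solution p q z = (THE f. ode_solution p q z f \<and> f 0 = 0 \<and>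
     (f has_vector_derivative 1) (at 0 within {0..}) \<and> (\<forall>x<0. f x = 0))"

text \<open>Boundary values of omega = sqrt((q - z)/p) (Re omega > 0) at z = lam + i0 (sg = 1)
  and z = lam - i0 (sg = -1).\<close>
definition omega_bv :: "(real \<Rightarrow> real) \<Rightarrow> (real \<Rightarrow> real) \<Rightarrow> real \<Rightarrow> real \<Rightarrow> real \<Rightarrow> complex" where
  "omega_bv p q sg lam x =
     complex_of_real (sqrt (pos_part ((q x - lam) / p x)))
     - \<i> * complex_of_real (sg * sqrt (pos_part ((lam - q x) / p x)))"

definition jost_a :: "(real \<Rightarrow> real) \<Rightarrow> (real \<Rightarrow> real) \<Rightarrow> real \<Rightarrow> real \<Rightarrow> real \<Rightarrow> complex" where
  "jost_a p q sg lam x = exp (- (LINT y:{0..x}|lborel. omega_bv p q sg lam y))"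

definition jost_bv ::
  "(real \<Rightarrow> real) \<Rightarrow> (real \<Rightarrow> real) \<Rightarrow> (real \<Rightarrow> real) \<Rightarrow> (real \<Rightarrow> real) \<Rightarrow> real \<Rightarrow> real \<Rightarrow> real
   \<Rightarrow> real \<Rightarrow> complex" where
  "jost_bv p p' q q' x0 sg lam = (THE f. ode_solution p q (complex_of_real lam) f \<and>
     (\<exists>C. \<forall>\<^sub>F x in at_top. cmod (f x / jost_a p q sg lam x - 1) \<le> C * eps_fun p' q' x0 x) \<and>
     (\<forall>x<0. f x = 0))"

definition wronsk_bv ::
  "(real \<Rightarrow> real) \<Rightarrow> (real \<Rightarrow> real) \<Rightarrow> (real \<Rightarrow> real) \<Rightarrow> (real \<Rightarrow> real) \<Rightarrow> real \<Rightarrow> real \<Rightarrow> real \<Rightarrow> complex" where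
  "wronsk_bv p p' q q' x0 sg lam = complex_of_real (p 0) * jost_bv p p' q q' x0 sg lam 0"

definition kappa_fun ::
  "(real \<Rightarrow> real) \<Rightarrow> (real \<Rightarrow> real) \<Rightarrow> (real \<Rightarrow> real) \<Rightarrow> (real \<Rightarrow> real) \<Rightarrow> real \<Rightarrow> real \<Rightarrow> real" where
  "kappa_fun p p' q q' x0 lam = cmod (wronsk_bv p p' q q' x0 1 lam)"

definition K_fun :: "(real \<Rightarrow> real) \<Rightarrow> (real \<Rightarrow> real) \<Rightarrow> real \<Rightarrow> real" where
  "K_fun p q lam = exp (- (LINT y:{0..}|lborel. sqrt (pos_part ((q y - lam) / p y))))"

definition Phi_fun :: "(real \<Rightarrow> real) \<Rightarrow> (real \<Rightarrow> real) \<Rightarrow> real \<Rightarrow> real \<Rightarrow> real" where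
  "Phi_fun p q x lam = (LINT y:{0..x}|lborel. sqrt (pos_part ((lam - q y) / p y)))"

text \<open>H^1_0(R_+): f (continuous representative) with f(0) = 0, f = \<integral>_0^x d, f, d \<in> L^2(R_+).\<close>
definition H10_with_deriv :: "(real \<Rightarrow> complex) \<Rightarrow> (real \<Rightarrow> complex) \<Rightarrow> bool" where
  "H10_with_deriv f d \<longleftrightarrow> f 0 = 0 \<and>
     (\<forall>x\<ge>0. set_integrable lborel {0..x} d \<and> f x = (LINT t:{0..x}|lborel. d t)) \<and>
     set_borel_measurable lborel {0..} f \<and> set_integrable lborel {0..} (\<lambda>x. (cmod (f x))\<^sup>2) \<and>
     set_borel_measurable lborel {0..} d \<and> set_integrable lborel {0..} (\<lambda>x. (cmod (d x))\<^sup>2)"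

text \<open>lam is an eigenvalue of the form-defined operator H: there is a nonzero f in the form domain
  H^1_0 with h[f,g] = lam <f,g> for all g in H^1_0 (i.e. f \<in> dom H and H f = lam f).\<close>
definition is_eigenvalue_H :: "(real \<Rightarrow> real) \<Rightarrow> (real \<Rightarrow> real) \<Rightarrow> real \<Rightarrow> bool" where
  "is_eigenvalue_H p q lam \<longleftrightarrow> (\<exists>f d. H10_with_deriv f d \<and> (\<exists>x\<ge>0. f x \<noteq> 0) \<and>
     (\<forall>g e. H10_with_deriv g e \<longrightarrow>
        (LINT x:{0..}|lborel. complex_of_real (p x) * d x * cnj (e x)
                               + complex_of_real (q x) * f x * cnj (g x))
        = complex_of_real lam * (LINT x:{0..}|lborel. f x * cnj (g x))))"

end

theory Submission
  imports Defs
begin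

text \<open>
  For \<open>\<lambda> > 0\<close> the coefficient \<open>\<lambda> - q\<close> is positive near infinity.  There the amplitudes
  \<open>c\<^sub>\<plusminus> = (f \<mp> i p f' / sqrt (p (\<lambda> - q))) exp (\<mp> i \<Phi>) / 2\<close> of a solution \<open>f\<close> have derivative
  \<open>\<mp> (i/2) p f' ((p (\<lambda> - q))\<^bsup>-1/2\<^esup>)' exp (\<mp> i \<Phi>)\<close>.  The energy \<open>p (\<lambda> - q) |f|\<^sup>2 + |p f'|\<^sup>2\<close> is
  bounded, so this derivative is \<open>O(|p'| + |q'|)\<close> and the amplitudes converge at rate \<open>O(\<epsilon>)\<close>.
  The Wronskian of two solutions is \<open>2 i sqrt (p\<^sub>0 \<lambda>)\<close> times the determinant of their limit amplitudes.
  Hence a solution is determined by its limit amplitudes, all pairs occur, the Jost solutions are those with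
  amplitudes \<open>(K, 0)\<close> and \<open>(0, K)\<close>, and the amplitudes of \<open>\<phi>\<close> are read off from its Wronskians
  with them.  An eigenfunction \<open>f\<close> would have \<open>f\<close> and \<open>p f'\<close> in \<open>L\<^sup>2\<close>, so its constant Wronskian with
  any (bounded) solution would be square integrable, hence zero.
\<close>

section \<open>Absolutely continuous functions\<close>

text \<open>Since \<open>p\<close> and \<open>q\<close> have only integrable derivatives, and
  \<open>q\<close> is merely integrable on \<open>{0..x0}\<close>, equations hold only almost
  everywhere. Calculus is therefore done on pairs \<open>ac_from a F f\<close>, with
  \<open>F\<close> an indefinite integral of \<open>f\<close>; the product and chain rules come from
  comparing increments over short intervals, not from differentiation almost everywhere. The factor
  K appears because \<open>q\<close> may exceed \<open>lam\<close> on a bounded set: there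
  \<open>jost_a\<close> loses modulus, and beyond it the modulus stays equal to K.
  \<open>jost_bv\<close> and \<open>regular_solution\<close> are definite descriptions, so each
  needs existence and uniqueness. For the Jost solutions both follow from the bijection between
  initial data and amplitudes, which takes the place of the integral equation for \<open>u\<close>.
  The description of \<open>jost_bv\<close> controls only \<open>f\<close> and not
  \<open>p f'\<close>, so uniqueness also needs that a solution tending to zero has zero amplitudes;
  this uses that the phase grows without bound. An eigenfunction is given only through a weak
  identity, so it must first be shown to solve the differential equation.\<close>

definition ac_from :: "real \<Rightarrow> (real \<Rightarrow> 'a::euclidean_space) \<Rightarrow> (real \<Rightarrow> 'a) \<Rightarrow> bool" where
  "ac_from a F f \<longleftrightarrow>
     (\<forall>x\<ge>a. set_integrable lborel {a..x} f \<and> F x = F a + (LINT t:{a..x}|lborel. f t))"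

lemma LINT_singleton: "(LINT t:{a..a}|lborel. f t) = (0::'a::euclidean_space)" for a :: real
proof -
  have "AE t in lborel. t \<noteq> a" by (rule AE_lborel_singleton)
  then have "AE t in lborel. indicator {a..a} t *\<^sub>R f t = 0" by eventually_elim auto
  then show ?thesis unfolding set_lebesgue_integral_def by (rule integral_eq_zero_AE)
qed

lemma set_integrable_Icc_combine:
  fixes f :: "real \<Rightarrow> 'a::euclidean_space"
  assumes "set_integrable lborel {a..b} f" "set_integrable lborel {b..c} f"
  shows "set_integrable lborel {a..c} f"
proof -
  have "set_integrable lborel ({a..b} \<union> {b..c}) f"
    using assms by (rule set_integrable_Un) auto
  then show ?thesis by (rule set_integrable_subset) auto
qed

lemma LINT_Icc_combine:
  fixes f :: "real \<Rightarrow> 'a::euclidean_space"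
  assumes "a \<le> b" "b \<le> c" "set_integrable lborel {a..c} f"
  shows "(LINT t:{a..c}|lborel. f t) = (LINT t:{a..b}|lborel. f t) + (LINT t:{b..c}|lborel. f t)"
proof -
  have *: "set_integrable lborel {a..b} f" "set_integrable lborel {b..c} f"
    using assms by (auto intro: set_integrable_subset)
  have "f integrable_on {a..c}"
    using assms(3) by (rule set_borel_integral_eq_integral)
  then show ?thesis
    using assms * by (simp add: set_borel_integral_eq_integral(2) Henstock_Kurzweil_Integration.integral_combine)
qed

text \<open>The integral over \<open>{a..a}\<close> is zero, which forces \<open>c\<close> to be
  \<open>F a\<close>; callers need not identify that value.\<close>

lemma ac_from_I:
  fixes f :: "real \<Rightarrow> 'a::euclidean_space"
  assumes "\<And>x. a \<le> x \<Longrightarrow> set_integrable lborel {a..x} f"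
    and "\<And>x. a \<le> x \<Longrightarrow> F x = c + (LINT t:{a..x}|lborel. f t)"
  shows "ac_from a F f"
  unfolding ac_from_def using assms LINT_singleton[of a f] by simp

lemma ac_from_D:
  assumes "ac_from a F f" "a \<le> x"
  shows "set_integrable lborel {a..x} f" "F x = F a + (LINT t:{a..x}|lborel. f t)"
  using assms unfolding ac_from_def by blast+

lemma ac_from_integrable:
  assumes "ac_from a F f" "a \<le> x"
  shows "set_integrable lborel {x..y} f"
proof (cases "x \<le> y")
  case True
  then have "set_integrable lborel {a..y} f" using assms by (intro ac_from_D(1)) auto
  then show ?thesis by (rule set_integrable_subset) (use assms in auto)
qed auto

lemma ac_from_diff:
  assumes "ac_from a F f" "a \<le> x" "x \<le> y"
  shows "F y - F x = (LINT t:{x..y}|lborel. f t)"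
proof -
  have "F x = F a + (LINT t:{a..x}|lborel. f t)" "F y = F a + (LINT t:{a..y}|lborel. f t)"
    using assms by (auto intro!: ac_from_D(2))
  moreover have "set_integrable lborel {a..y} f" using assms by (auto intro: ac_from_integrable)
  ultimately show ?thesis using LINT_Icc_combine[of a x y f] assms by simp
qed

lemma ac_from_mono:
  assumes "ac_from a F f" "a \<le> b"
  shows "ac_from b F f"
  unfolding ac_from_def
proof (intro allI impI conjI ac_from_integrable[OF assms])
  fix x assume "b \<le> x"
  from ac_from_diff[OF assms this] show "F x = F b + (LINT t:{b..x}|lborel. f t)"
    by (simp add: algebra_simps)
qed

lemma ac_from_cong:
  assumes "ac_from a F f" "\<And>x. a \<le> x \<Longrightarrow> F x = G x" "\<And>x. a \<le> x \<Longrightarrow> f x = g x"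
  shows "ac_from a G g"
proof -
  have "set_integrable lborel {a..x} g \<longleftrightarrow> set_integrable lborel {a..x} f" for x
    by (rule set_integrable_cong) (use assms in auto)
  moreover have "(LINT t:{a..x}|lborel. g t) = (LINT t:{a..x}|lborel. f t)" for x
    by (rule set_lebesgue_integral_cong) (use assms in auto)
  ultimately show ?thesis
    by (intro ac_from_I[where c = "F a"])
      (simp_all add: ac_from_D(1)[OF assms(1)] assms(2)[symmetric] ac_from_D(2)[OF assms(1), symmetric])
qed

lemma ac_from_continuous:
  assumes "ac_from a F f"
  shows "continuous_on {a..} F"
proof -
  have c: "continuous_on {a..b} F" for b
  proof -
    have "f integrable_on {a..b}"
      using ac_from_integrable[OF assms order_refl, of b] by (rule set_borel_integral_eq_integral)
    then have "continuous_on {a..b} (\<lambda>x. F a + integral {a..x} f)"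
      by (intro continuous_intros indefinite_integral_continuous_1)
    moreover have "F a + integral {a..x} f = F x" if "x \<in> {a..b}" for x
      using ac_from_D[OF assms, of x] that
      by (metis atLeastAtMost_iff set_borel_integral_eq_integral(2))
    ultimately show ?thesis by (rule continuous_on_eq)
  qed
  have "continuous (at x within {a..}) F" if "x \<in> {a..}" for x
  proof -
    have "continuous (at x within {a..x+1}) F"
      using c[of "x+1"] that by (simp add: continuous_on_eq_continuous_within)
    moreover have "at x within {a..x+1} = at x within {a..}"
      by (rule at_within_nhd[of _ "{..<x+1}"]) auto
    ultimately show ?thesis by simp
  qed
  then show ?thesis by (simp add: continuous_on_eq_continuous_within)
qed

lemma ac_from_bounded_linear:
  fixes f :: "real \<Rightarrow> 'a::euclidean_space" and T :: "'a \<Rightarrow> 'b::euclidean_space"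
  assumes "bounded_linear T" "ac_from a F f"
  shows "ac_from a (\<lambda>x. T (F x)) (\<lambda>x. T (f x))"
proof -
  interpret bounded_linear T by fact
  show ?thesis
    unfolding ac_from_def
  proof (intro allI impI conjI)
    fix x assume x: "a \<le> x"
    have i: "set_integrable lborel {a..x} f" using assms x by (intro ac_from_D(1))
    show "set_integrable lborel {a..x} (\<lambda>x. T (f x))"
      using integrable_bounded_linear[OF assms(1) i[unfolded set_integrable_def]]
      by (simp add: set_integrable_def scaleR)
    have "(LINT t:{a..x}|lborel. T (f t)) = T (LINT t:{a..x}|lborel. f t)"
      using integral_bounded_linear[OF assms(1) i[unfolded set_integrable_def]]
      by (simp add: set_lebesgue_integral_def scaleR)
    then show "T (F x) = T (F a) + (LINT t:{a..x}|lborel. T (f t))"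
      using ac_from_D(2)[OF assms(2) x] by (metis add)
  qed
qed

lemma ac_from_add:
  assumes "ac_from a F f" "ac_from a G g"
  shows "ac_from a (\<lambda>x. F x + G x) (\<lambda>x. f x + g x)"
  unfolding ac_from_def
proof (intro allI impI conjI)
  fix x assume x: "a \<le> x"
  have i: "set_integrable lborel {a..x} f" "set_integrable lborel {a..x} g"
    and e: "F x = F a + (LINT t:{a..x}|lborel. f t)" "G x = G a + (LINT t:{a..x}|lborel. g t)"
    using ac_from_D[OF assms(1) x] ac_from_D[OF assms(2) x] by auto
  show "set_integrable lborel {a..x} (\<lambda>x. f x + g x)" using i by (rule set_integral_add)
  show "F x + G x = F a + G a + (LINT t:{a..x}|lborel. f t + g t)"
    using set_integral_add(2)[OF i] e by simp
qed

lemma ac_from_minus: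
  assumes "ac_from a F f"
  shows "ac_from a (\<lambda>x. - F x) (\<lambda>x. - f x)"
  using ac_from_bounded_linear[OF bounded_linear_minus[OF bounded_linear_ident] assms] .

lemma ac_from_sub:
  assumes "ac_from a F f" "ac_from a G g"
  shows "ac_from a (\<lambda>x. F x - G x) (\<lambda>x. f x - g x)"
  using ac_from_add[OF assms(1) ac_from_minus[OF assms(2)]] by simp

lemma ac_from_const: "ac_from a (\<lambda>x. c) (\<lambda>x. 0)"
  unfolding ac_from_def by (simp add: set_integrable_def)

lemma ac_from_cmult:
  fixes F :: "real \<Rightarrow> 'a::{euclidean_space, real_normed_field}"
  assumes "ac_from a F f"
  shows "ac_from a (\<lambda>x. c * F x) (\<lambda>x. c * f x)"
  by (rule ac_from_bounded_linear[OF bounded_linear_mult_right assms])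

lemma ac_from_of_real:
  "ac_from a F f \<Longrightarrow> ac_from a (\<lambda>x. complex_of_real (F x)) (\<lambda>x. complex_of_real (f x))"
  by (rule ac_from_bounded_linear[OF bounded_linear_of_real])

lemma ac_from_cnj: "ac_from a F f \<Longrightarrow> ac_from a (\<lambda>x. cnj (F x)) (\<lambda>x. cnj (f x))"
  by (rule ac_from_bounded_linear[OF bounded_linear_cnj])

section \<open>Integrability of products and norm bounds for integrals\<close>

lemma set_integrable_of_real:
  assumes "set_integrable lborel A h"
  shows "set_integrable lborel A (\<lambda>t. complex_of_real (h t))"
  using integrable_bounded_linear[OF bounded_linear_of_real[where 'a = complex] assms[unfolded set_integrable_def]]
  by (simp add: set_integrable_def scaleR_conv_of_real)

lemma set_measurable_of_continuous:
  fixes f :: "real \<Rightarrow> 'a::euclidean_space"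
  assumes "continuous_on {a..b} f"
  shows "set_borel_measurable lborel {a..b} f"
  using assms by (simp add: borel_measurable_continuous_on_indicator set_borel_measurable_def)

lemma set_integrable_mult_bounded:
  fixes f G :: "real \<Rightarrow> 'a::{euclidean_space, real_normed_field}"
  assumes "set_integrable lborel A f" "set_borel_measurable lborel A G"
    "\<And>x. x \<in> A \<Longrightarrow> norm (G x) \<le> B"
  shows "set_integrable lborel A (\<lambda>x. f x * G x)"
proof -
  have "set_integrable lborel A (\<lambda>x. B * norm (f x))"
    using set_integrable_norm[OF assms(1)] by simp
  moreover have "set_borel_measurable lborel A (\<lambda>x. f x * G x)"
  proof -
    \<comment> \<open>Measurability is known only on \<open>A\<close>, so each factor carries its
      own indicator; their product is again the indicator.\<close>
    have "(\<lambda>x. (indicator A x *\<^sub>R f x) * (indicator A x *\<^sub>R G x)) \<in> borel_measurable lborel"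
      using borel_measurable_integrable[OF assms(1)[unfolded set_integrable_def]]
        assms(2)[unfolded set_borel_measurable_def] by (rule borel_measurable_times)
    also have "(\<lambda>x. (indicator A x *\<^sub>R f x) * (indicator A x *\<^sub>R G x)) = (\<lambda>x. indicator A x *\<^sub>R (f x * G x))"
      by (auto simp: fun_eq_iff indicator_def)
    finally show ?thesis by (simp add: set_borel_measurable_def)
  qed
  ultimately show ?thesis
    by (rule set_integrable_bound)
      (auto simp: norm_mult mult.commute intro!: AE_I2 order_trans[OF mult_right_mono[OF assms(3)]])
qed

lemma set_integrable_mult_continuous:
  fixes f G :: "real \<Rightarrow> 'a::{euclidean_space, real_normed_field}"
  assumes "set_integrable lborel {a..b} f" "continuous_on {a..b} G"
  shows "set_integrable lborel {a..b} (\<lambda>x. f x * G x)"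
proof -
  have "compact (G ` {a..b})" using assms(2) by (intro compact_continuous_image) auto
  then obtain B where "\<forall>y\<in>G ` {a..b}. norm y \<le> B"
    by (meson bounded_iff compact_imp_bounded)
  moreover have "set_borel_measurable lborel {a..b} G"
    using assms(2) by (rule set_measurable_of_continuous)
  ultimately show ?thesis by (intro set_integrable_mult_bounded[OF assms(1)]) auto
qed

lemma norm_set_integral_le:
  fixes f :: "real \<Rightarrow> 'a::euclidean_space"
  assumes "set_integrable lborel A f" "set_integrable lborel A b"
    "\<And>x. x \<in> A \<Longrightarrow> norm (f x) \<le> b x"
  shows "norm (LINT x:A|lborel. f x) \<le> (LINT x:A|lborel. b x)"
proof -
  have "norm (LINT x:A|lborel. f x) \<le> (LINT x:A|lborel. norm (f x))"
    by (rule set_integral_norm_bound[OF assms(1)])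
  also have "\<dots> \<le> (LINT x:A|lborel. b x)"
    by (rule set_integral_mono) (use assms set_integrable_norm in auto)
  finally show ?thesis .
qed

text \<open>Over a partition of mesh below \<delta> the bounds telescope to
  \<open>e * (V b - V a)\<close>, with \<open>e\<close> arbitrary. In the uses below
  \<open>V\<close> is the primitive of a majorant.\<close>

lemma eq_of_small_increments:
  fixes \<phi> :: "real \<Rightarrow> 'a::real_normed_vector" and V :: "real \<Rightarrow> real"
  assumes ab: "a \<le> b"
    and inc: "\<And>e. e > 0 \<Longrightarrow> \<exists>\<delta>>0. \<forall>x y. a \<le> x \<longrightarrow> x \<le> y \<longrightarrow> y \<le> b \<longrightarrow> y - x < \<delta> \<longrightarrow>
        norm (\<phi> y - \<phi> x) \<le> e * (V y - V x)"
  shows "\<phi> b = \<phi> a"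
proof -
  have bound: "norm (\<phi> b - \<phi> a) \<le> e * (V b - V a)" if e: "e > 0" for e
  proof -
    obtain \<delta> where \<delta>: "\<delta> > 0" and d: "\<And>x y. a \<le> x \<Longrightarrow> x \<le> y \<Longrightarrow> y \<le> b \<Longrightarrow> y - x < \<delta> \<Longrightarrow>
        norm (\<phi> y - \<phi> x) \<le> e * (V y - V x)"
      using inc[OF e] by blast
    obtain n where n: "(b - a) / \<delta> < real n" using reals_Archimedean2 by blast
    have n0: "n > 0" using n ab \<delta> by (metis divide_nonneg_pos diff_ge_0_iff_ge gr0I of_nat_0 not_less)
    define h where "h = (b - a) / n"
    have h: "0 \<le> h" "h < \<delta>" "n * h = b - a"
      using n n0 ab \<delta> by (auto simp: h_def field_simps)
    have "i \<le> n \<Longrightarrow> norm (\<phi> (a + i * h) - \<phi> a) \<le> e * (V (a + i * h) - V a)" for i :: nat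
    proof (induction i)
      case (Suc i)
      have "Suc i * h \<le> n * h" using Suc.prems h(1) by (intro mult_right_mono) auto
      then have "norm (\<phi> (a + Suc i * h) - \<phi> (a + i * h)) \<le> e * (V (a + Suc i * h) - V (a + i * h))"
        using h by (intro d) (auto simp: algebra_simps)
      moreover have "norm (\<phi> (a + i * h) - \<phi> a) \<le> e * (V (a + i * h) - V a)"
        using Suc by simp
      ultimately show ?case
        using norm_triangle_ineq[of "\<phi> (a + Suc i * h) - \<phi> (a + i * h)" "\<phi> (a + i * h) - \<phi> a"]
        by (simp add: algebra_simps)
    qed simp
    from this[of n] h show ?thesis by simp
  qed
  have "norm (\<phi> b - \<phi> a) \<le> 0"
  proof (rule field_le_epsilon)
    fix e :: real assume e: "e > 0"
    \<comment> \<open>Adding 1 keeps the denominator positive when \<open>V b = V a\<close>.\<close>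
    have "norm (\<phi> b - \<phi> a) \<le> e / (\<bar>V b - V a\<bar> + 1) * (V b - V a)"
      using e by (intro bound) auto
    also have "\<dots> \<le> e / (\<bar>V b - V a\<bar> + 1) * (\<bar>V b - V a\<bar> + 1)"
      using e by (intro mult_left_mono) auto
    finally show "norm (\<phi> b - \<phi> a) \<le> 0 + e" by simp
  qed
  then show ?thesis by simp
qed

lemma ac_from_indefinite_integral:
  fixes f :: "real \<Rightarrow> 'a::euclidean_space"
  assumes "\<And>x. a \<le> x \<Longrightarrow> set_integrable lborel {a..x} f"
  shows "ac_from a (\<lambda>x. c + (LINT t:{a..x}|lborel. f t)) f"
  by (rule ac_from_I[OF assms]) auto

text \<open>Subtracting the primitive of the candidate derivative \<open>h\<close> leaves a function
  whose increments are small relative to those of the primitive of \<open>v\<close>, hence a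
  constant. Since \<delta> may depend on \<open>b\<close>, uniform continuity on compact intervals
  suffices to apply this.\<close>

lemma ac_from_I_increments:
  fixes F :: "real \<Rightarrow> 'a::euclidean_space"
  assumes int: "\<And>x. a \<le> x \<Longrightarrow> set_integrable lborel {a..x} h"
    and v: "\<And>x. a \<le> x \<Longrightarrow> set_integrable lborel {a..x} v"
    and inc: "\<And>b e. a \<le> b \<Longrightarrow> e > 0 \<Longrightarrow> \<exists>\<delta>>0. \<forall>x y. a \<le> x \<longrightarrow> x \<le> y \<longrightarrow> y \<le> b \<longrightarrow> y - x < \<delta> \<longrightarrow>
        norm (F y - F x - (LINT t:{x..y}|lborel. h t)) \<le> e * (LINT t:{x..y}|lborel. v t)"
  shows "ac_from a F h"
proof (rule ac_from_I[where c = "F a", OF int])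
  fix b assume ab: "a \<le> b"
  define \<phi> where "\<phi> = (\<lambda>x. F x - (0 + (LINT t:{a..x}|lborel. h t)))"
  define V where "V = (\<lambda>x. 0 + (LINT t:{a..x}|lborel. v t))"
  have H: "ac_from a (\<lambda>x. 0 + (LINT t:{a..x}|lborel. h t)) h" and V: "ac_from a V v"
    unfolding V_def by (intro ac_from_indefinite_integral int v; simp)+
  have "\<phi> b = \<phi> a"
  proof (rule eq_of_small_increments[OF ab, where V = V])
    fix e :: real assume e: "e > 0"
    from inc[OF ab this] obtain \<delta> where \<delta>: "\<delta> > 0" "\<And>x y. a \<le> x \<Longrightarrow> x \<le> y \<Longrightarrow> y \<le> b \<Longrightarrow> y - x < \<delta> \<Longrightarrow>
        norm (F y - F x - (LINT t:{x..y}|lborel. h t)) \<le> e * (LINT t:{x..y}|lborel. v t)" by blast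
    show "\<exists>\<delta>>0. \<forall>x y. a \<le> x \<longrightarrow> x \<le> y \<longrightarrow> y \<le> b \<longrightarrow> y - x < \<delta> \<longrightarrow>
        norm (\<phi> y - \<phi> x) \<le> e * (V y - V x)"
    proof (intro exI[of _ \<delta>] conjI allI impI \<delta>(1))
      fix x y assume xy: "a \<le> x" "x \<le> y" "y \<le> b" "y - x < \<delta>"
      have "\<phi> y - \<phi> x = F y - F x - (LINT t:{x..y}|lborel. h t)"
        using ac_from_diff[OF H xy(1,2)] by (simp add: \<phi>_def algebra_simps)
      then show "norm (\<phi> y - \<phi> x) \<le> e * (V y - V x)"
        using \<delta>(2)[OF xy] ac_from_diff[OF V xy(1,2)] by simp
    qed
  qed
  then show "F b = F a + (LINT t:{a..b}|lborel. h t)"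
    using LINT_singleton[of a h] by (simp add: \<phi>_def algebra_simps)
qed

lemma uniform_continuity_Icc:
  fixes F :: "real \<Rightarrow> 'a::real_normed_vector"
  assumes "continuous_on {a..} F" "e > 0"
  obtains \<delta> where "\<delta> > 0" "\<And>s t. a \<le> s \<Longrightarrow> s \<le> b \<Longrightarrow> a \<le> t \<Longrightarrow> t \<le> b \<Longrightarrow> \<bar>s - t\<bar> < \<delta> \<Longrightarrow> norm (F s - F t) \<le> e"
proof -
  have "uniformly_continuous_on {a..b} F"
    by (rule compact_uniformly_continuous) (use assms in \<open>auto intro: continuous_on_subset\<close>)
  then obtain d where "d > 0"
      "\<And>s t. s \<in> {a..b} \<Longrightarrow> t \<in> {a..b} \<Longrightarrow> dist t s < d \<Longrightarrow> dist (F t) (F s) < e"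
    using assms(2) unfolding uniformly_continuous_on_def by blast
  then show ?thesis by (intro that[of d]) (auto simp: dist_norm intro!: less_imp_le)
qed

lemma ac_from_mult:
  fixes F G :: "real \<Rightarrow> 'a::{euclidean_space, real_normed_field}"
  assumes F: "ac_from a F f" and G: "ac_from a G g"
  shows "ac_from a (\<lambda>x. F x * G x) (\<lambda>x. f x * G x + F x * g x)"
proof (rule ac_from_I_increments[where v = "\<lambda>x. norm (f x) + norm (g x)"])
  have cF: "continuous_on {a..} F" and cG: "continuous_on {a..} G"
    using F G by (auto intro: ac_from_continuous)
  have cs: "continuous_on {x..y} F" "continuous_on {x..y} G" if "a \<le> x" for x y
    using cF cG that by (auto intro: continuous_on_subset)
  have i1: "set_integrable lborel {x..y} (\<lambda>t. f t * G t)" if "a \<le> x" for x y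
    using that cs F by (intro set_integrable_mult_continuous) (auto intro: ac_from_integrable)
  have i2: "set_integrable lborel {x..y} (\<lambda>t. F t * g t)" if "a \<le> x" for x y
    using set_integrable_mult_continuous[OF ac_from_integrable[OF G that] cs(1)[OF that]]
    by (simp add: mult.commute)
  have iF: "set_integrable lborel {x..y} f" and iG: "set_integrable lborel {x..y} g" if "a \<le> x" for x y
    using F G that by (auto intro: ac_from_integrable)
  show "set_integrable lborel {a..x} (\<lambda>x. f x * G x + F x * g x)" for x
    by (intro set_integral_add i1 i2) auto
  show "set_integrable lborel {a..x} (\<lambda>x. norm (f x) + norm (g x))" for x
    by (intro set_integral_add set_integrable_norm iF iG) auto
  fix b e :: real assume "a \<le> b" and e: "e > 0"
  obtain d1 where d1: "d1 > 0" "\<And>s t. a \<le> s \<Longrightarrow> s \<le> b \<Longrightarrow> a \<le> t \<Longrightarrow> t \<le> b \<Longrightarrow> \<bar>s - t\<bar> < d1 \<Longrightarrow> norm (F s - F t) \<le> e"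
    using uniform_continuity_Icc[OF cF e] by blast
  obtain d2 where d2: "d2 > 0" "\<And>s t. a \<le> s \<Longrightarrow> s \<le> b \<Longrightarrow> a \<le> t \<Longrightarrow> t \<le> b \<Longrightarrow> \<bar>s - t\<bar> < d2 \<Longrightarrow> norm (G s - G t) \<le> e"
    using uniform_continuity_Icc[OF cG e] by blast
  show "\<exists>\<delta>>0. \<forall>x y. a \<le> x \<longrightarrow> x \<le> y \<longrightarrow> y \<le> b \<longrightarrow> y - x < \<delta> \<longrightarrow>
        norm (F y * G y - F x * G x - (LINT t:{x..y}|lborel. f t * G t + F t * g t))
          \<le> e * (LINT t:{x..y}|lborel. norm (f t) + norm (g t))"
  proof (intro exI[of _ "min d1 d2"] conjI allI impI)
    show "min d1 d2 > 0" using d1 d2 by simp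
    fix x y assume xy: "a \<le> x" "x \<le> y" "y \<le> b" "y - x < min d1 d2"
    \<comment> \<open>\<open>G\<close> is frozen at the right end and \<open>F\<close> at the left
      end. Letting them vary again costs \<open>f t * (G y - G t) + (F x - F t) * g t\<close>, which
      uniform continuity makes small against \<open>norm (f t) + norm (g t)\<close>.\<close>
    have "F y * G y - F x * G x = (F y - F x) * G y + F x * (G y - G x)" by (simp add: algebra_simps)
    also have "\<dots> = (LINT t:{x..y}|lborel. f t) * G y + F x * (LINT t:{x..y}|lborel. g t)"
      using ac_from_diff[OF F xy(1,2)] ac_from_diff[OF G xy(1,2)] by simp
    also have "\<dots> = (LINT t:{x..y}|lborel. f t * G y) + (LINT t:{x..y}|lborel. F x * g t)"
      by simp
    also have "\<dots> = (LINT t:{x..y}|lborel. f t * G y + F x * g t)"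
      by (intro set_integral_add(2)[symmetric]) (auto simp: iF iG xy)
    finally have "F y * G y - F x * G x - (LINT t:{x..y}|lborel. f t * G t + F t * g t)
       = (LINT t:{x..y}|lborel. (f t * G y + F x * g t) - (f t * G t + F t * g t))"
      using set_integral_diff(2)[of lborel "{x..y}" "\<lambda>t. f t * G y + F x * g t" "\<lambda>t. f t * G t + F t * g t"]
        set_integral_add(1)[OF i1 i2] set_integral_add(1)[of lborel "{x..y}" "\<lambda>t. f t * G y" "\<lambda>t. F x * g t"]
        iF iG xy by simp
    also have "norm \<dots> \<le> (LINT t:{x..y}|lborel. e * (norm (f t) + norm (g t)))"
    proof (rule norm_set_integral_le)
      show "set_integrable lborel {x..y} (\<lambda>t. (f t * G y + F x * g t) - (f t * G t + F t * g t))"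
        by (intro set_integral_diff set_integral_add i1 i2 set_integrable_mult_left set_integrable_mult_right iF iG xy)
      show "set_integrable lborel {x..y} (\<lambda>t. e * (norm (f t) + norm (g t)))"
        by (intro set_integrable_mult_right set_integral_add set_integrable_norm iF iG xy)
      fix t assume t: "t \<in> {x..y}"
      have "(f t * G y + F x * g t) - (f t * G t + F t * g t) = f t * (G y - G t) + (F x - F t) * g t"
        by (simp add: algebra_simps)
      also have "norm \<dots> \<le> norm (f t) * norm (G y - G t) + norm (F x - F t) * norm (g t)"
        by (metis norm_triangle_ineq norm_mult)
      also have "\<dots> \<le> norm (f t) * e + e * norm (g t)"
        using t xy by (intro add_mono mult_left_mono mult_right_mono d1 d2) auto
      finally show "norm ((f t * G y + F x * g t) - (f t * G t + F t * g t)) \<le> e * (norm (f t) + norm (g t))"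
        by (simp add: algebra_simps)
    qed
    finally show "norm (F y * G y - F x * G x - (LINT t:{x..y}|lborel. f t * G t + F t * g t))
          \<le> e * (LINT t:{x..y}|lborel. norm (f t) + norm (g t))" by simp
  qed
qed

text \<open>The mean value theorem turns an increment of \<open>h (F x)\<close> into
  \<open>h' (F s)\<close> times an increment of \<open>F\<close>, and uniform continuity replaces
  the fixed \<open>s\<close> by the integration variable. Only the values of \<open>F\<close> must
  lie in \<open>I\<close>, so \<open>h\<close> may be singular elsewhere, as the inverse square root
  is at 0.\<close>

lemma ac_from_chain:
  fixes F :: "real \<Rightarrow> real"
  assumes F: "ac_from a F f"
    and h: "\<And>u. u \<in> I \<Longrightarrow> (h has_real_derivative h' u) (at u)"
    and h': "continuous_on I h'" and I: "\<And>x. a \<le> x \<Longrightarrow> F x \<in> I"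
  shows "ac_from a (\<lambda>x. h (F x)) (\<lambda>x. h' (F x) * f x)"
proof (rule ac_from_I_increments[where v = "\<lambda>x. norm (f x)"])
  have cF: "continuous_on {a..} F" using F by (rule ac_from_continuous)
  have ch: "continuous_on {a..} (\<lambda>x. h' (F x))"
    by (rule continuous_on_compose2[OF h' cF]) (use I in auto)
  have i1: "set_integrable lborel {x..y} (\<lambda>t. h' (F t) * f t)" if "a \<le> x" for x y
  proof -
    have "continuous_on {x..y} (\<lambda>t. h' (F t))"
      by (rule continuous_on_subset[OF ch]) (use that in auto)
    from set_integrable_mult_continuous[OF ac_from_integrable[OF F that] this]
    show ?thesis by (simp add: mult.commute)
  qed
  have iF: "set_integrable lborel {x..y} f" if "a \<le> x" for x y
    using F that by (auto intro: ac_from_integrable)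
  show "set_integrable lborel {a..x} (\<lambda>t. h' (F t) * f t)" for x by (rule i1) simp
  show "set_integrable lborel {a..x} (\<lambda>t. norm (f t))" for x by (intro set_integrable_norm iF) simp
  fix b e :: real assume "a \<le> b" and e: "e > 0"
  obtain d where d: "d > 0" "\<And>s t. a \<le> s \<Longrightarrow> s \<le> b \<Longrightarrow> a \<le> t \<Longrightarrow> t \<le> b \<Longrightarrow> \<bar>s - t\<bar> < d \<Longrightarrow> norm (h' (F s) - h' (F t)) \<le> e"
    using uniform_continuity_Icc[OF ch e] by blast
  show "\<exists>\<delta>>0. \<forall>x y. a \<le> x \<longrightarrow> x \<le> y \<longrightarrow> y \<le> b \<longrightarrow> y - x < \<delta> \<longrightarrow>
        norm (h (F y) - h (F x) - (LINT t:{x..y}|lborel. h' (F t) * f t)) \<le> e * (LINT t:{x..y}|lborel. norm (f t))"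
  proof (intro exI[of _ d] conjI allI impI d(1))
    fix x y assume xy: "a \<le> x" "x \<le> y" "y \<le> b" "y - x < d"
    \<comment> \<open>the mean value point between \<open>F x\<close> and \<open>F y\<close> is itself a value of \<open>F\<close> on \<open>{x..y}\<close>\<close>
    have "\<exists>s\<in>{x..y}. h (F y) - h (F x) = h' (F s) * (F y - F x)"
    proof -
      have conn: "connected (F ` {x..y})"
        by (intro connected_continuous_image continuous_on_subset[OF cF]) (use xy in auto)
      have sub: "closed_segment (F x) (F y) \<subseteq> F ` {x..y}"
        using conn xy is_interval_connected_1[of "F ` {x..y}"]
        by (intro closed_segment_subset) (auto simp: is_interval_convex_1)
      have D: "(h has_real_derivative h' u) (at u)" if "u \<in> closed_segment (F x) (F y)" for u
        using sub that h I xy by fastforce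
      have "\<exists>u \<in> closed_segment (F x) (F y). h (F y) - h (F x) = h' u * (F y - F x)"
      proof (cases "F x" "F y" rule: linorder_cases)
        case less
        then obtain z where "F x < z" "z < F y" "h (F y) - h (F x) = (F y - F x) * h' z"
          using MVT2[of "F x" "F y" h h'] D by (auto simp: closed_segment_eq_real_ivl)
        then show ?thesis using less by (intro bexI[of _ z]) (auto simp: closed_segment_eq_real_ivl)
      next
        case greater
        then obtain z where "F y < z" "z < F x" "h (F x) - h (F y) = (F x - F y) * h' z"
          using MVT2[of "F y" "F x" h h'] D by (auto simp: closed_segment_eq_real_ivl)
        then show ?thesis using greater
          by (intro bexI[of _ z]) (auto simp: closed_segment_eq_real_ivl algebra_simps)
      qed (auto intro!: bexI[of _ "F x"])
      then show ?thesis using sub by blast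
    qed
    then obtain s where s: "s \<in> {x..y}" "h (F y) - h (F x) = h' (F s) * (F y - F x)" by blast
    have "h (F y) - h (F x) = (LINT t:{x..y}|lborel. h' (F s) * f t)"
      using s ac_from_diff[OF F xy(1,2)] by simp
    then have "h (F y) - h (F x) - (LINT t:{x..y}|lborel. h' (F t) * f t)
        = (LINT t:{x..y}|lborel. h' (F s) * f t - h' (F t) * f t)"
      using set_integral_diff(2)[of lborel "{x..y}" "\<lambda>t. h' (F s) * f t" "\<lambda>t. h' (F t) * f t"]
        i1[OF xy(1)] iF[OF xy(1)] by simp
    also have "norm \<dots> \<le> (LINT t:{x..y}|lborel. e * norm (f t))"
    proof (rule norm_set_integral_le)
      show "set_integrable lborel {x..y} (\<lambda>t. h' (F s) * f t - h' (F t) * f t)"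
        by (intro set_integral_diff i1 set_integrable_mult_right iF xy)
      show "set_integrable lborel {x..y} (\<lambda>t. e * norm (f t))"
        by (intro set_integrable_mult_right set_integrable_norm iF xy)
      fix t assume t: "t \<in> {x..y}"
      have "norm (h' (F s) * f t - h' (F t) * f t) = norm (h' (F s) - h' (F t)) * norm (f t)"
        by (simp only: left_diff_distrib[symmetric] norm_mult)
      also have "\<dots> \<le> e * norm (f t)"
        using t s xy by (intro mult_right_mono d) auto
      finally show "norm (h' (F s) * f t - h' (F t) * f t) \<le> e * norm (f t)" .
    qed
    finally show "norm (h (F y) - h (F x) - (LINT t:{x..y}|lborel. h' (F t) * f t)) \<le> e * (LINT t:{x..y}|lborel. norm (f t))"
      by simp
  qed
qed

section \<open>Linear differential equations\<close>

text \<open>Continuity is stated on the whole line, with value zero for negative \<open>x\<close>,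
  because the fixed point below is sought among bounded continuous functions on all of the
  reals.\<close>

lemma continuous_LINT_Icc:
  fixes f :: "real \<Rightarrow> 'a::euclidean_space"
  assumes "\<And>x. 0 \<le> x \<Longrightarrow> set_integrable lborel {0..x} f"
  shows "continuous_on UNIV (\<lambda>x. LINT t:{0..x}|lborel. f t)"
proof -
  define I where "I = (\<lambda>x. 0 + (LINT t:{0..x}|lborel. f t))"
  have "ac_from 0 I f" unfolding I_def by (rule ac_from_indefinite_integral[OF assms])
  then have "continuous_on {0..} I" by (rule ac_from_continuous)
  then have "continuous_on UNIV (\<lambda>x. I (max 0 x))"
    by (rule continuous_on_compose2) (auto intro!: continuous_intros)
  moreover have "I (max 0 x) = (LINT t:{0..x}|lborel. f t)" for x
    using LINT_singleton[of 0 f] by (cases "x < 0") (auto simp: I_def max_def set_lebesgue_integral_def)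
  ultimately show ?thesis by simp
qed

text \<open>Caratheodory conditions for a linear system: \<open>b\<close> is a locally integrable
  bound on the operator norm, and measurability is asked of exactly those integrands
  \<open>A t (Y t)\<close> that Picard iteration produces.\<close>

locale linear_ode =
  fixes A :: "real \<Rightarrow> 'v::euclidean_space \<Rightarrow> 'v" and b :: "real \<Rightarrow> real"
  assumes linear: "\<And>t. linear (A t)"
    and bound: "\<And>t v. 0 \<le> t \<Longrightarrow> norm (A t v) \<le> b t * norm v"
    and b_integrable: "\<And>x. 0 \<le> x \<Longrightarrow> set_integrable lborel {0..x} b"
    and b_nonneg: "\<And>t. 0 \<le> t \<Longrightarrow> 0 \<le> b t"
    and measurable: "\<And>Y x. continuous_on {0..x} Y \<Longrightarrow> set_borel_measurable lborel {0..x} (\<lambda>t. A t (Y t))"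
begin

text \<open>\<open>exp (2 * m x)\<close> serves as a Bielecki weight; the 2 in the exponent is the
  source of the contraction constant 1/2.\<close>

definition m :: "real \<Rightarrow> real" where "m x = (LINT t:{0..x}|lborel. b t)"

lemma m_continuous: "continuous_on UNIV m"
  unfolding m_def by (rule continuous_LINT_Icc[OF b_integrable])

lemma m_0: "m 0 = 0"
  using LINT_singleton[of 0 b] by (simp add: m_def)

lemma exp_m_ac: "ac_from 0 (\<lambda>x. exp (2 * m x)) (\<lambda>x. 2 * exp (2 * m x) * b x)"
proof (rule ac_from_chain[where I = UNIV and h = "\<lambda>u. exp (2 * u)" and h' = "\<lambda>u. 2 * exp (2 * u)"])
  show "ac_from 0 m b"
    using ac_from_indefinite_integral[OF b_integrable, of 0] by (simp add: m_def[abs_def])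
qed (auto intro!: derivative_eq_intros continuous_intros)

lemma weight_integrable: "set_integrable lborel {0..x} (\<lambda>t. b t * exp (2 * m t))"
  using set_integrable_mult_right[OF ac_from_integrable[OF exp_m_ac order_refl, of x], of "1/2"]
  by (simp add: mult.commute)

lemma weight_integral:
  assumes "0 \<le> x"
  shows "(LINT t:{0..x}|lborel. b t * exp (2 * m t)) = (exp (2 * m x) - 1) / 2"
proof -
  have "exp (2 * m x) - 1 = (LINT t:{0..x}|lborel. 2 * exp (2 * m t) * b t)"
    using ac_from_diff[OF exp_m_ac order_refl assms] by (simp add: m_0)
  also have "\<dots> = (LINT t:{0..x}|lborel. 2 * (b t * exp (2 * m t)))"
    by (simp add: mult_ac)
  also have "\<dots> = 2 * (LINT t:{0..x}|lborel. b t * exp (2 * m t))"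
    by (rule set_integral_mult_right)
  finally show ?thesis by simp
qed

lemma integrand_integrable:
  assumes "continuous_on {0..x} Y"
  shows "set_integrable lborel {0..x} (\<lambda>t. A t (Y t))"
proof (cases "0 \<le> x")
  case True
  have "set_integrable lborel {0..x} (\<lambda>t. b t * norm (Y t))"
    by (intro set_integrable_mult_continuous b_integrable True continuous_intros assms)
  then show ?thesis
    using measurable[OF assms] by (rule set_integrable_bound) (auto intro!: AE_I2 order_trans[OF bound])
qed auto

text \<open>With respect to the weight \<open>exp (2 * m)\<close> the integral operator has norm at
  most 1/2. Uniqueness and existence both rest on this estimate.\<close>

lemma integral_weighted_bound:
  assumes "continuous_on {0..x} Y" "0 \<le> x" "\<And>t. 0 \<le> t \<Longrightarrow> t \<le> x \<Longrightarrow> norm (Y t) \<le> M * exp (2 * m t)"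
  shows "norm (LINT t:{0..x}|lborel. A t (Y t)) \<le> M * ((exp (2 * m x) - 1) / 2)"
proof -
  have "norm (LINT t:{0..x}|lborel. A t (Y t)) \<le> (LINT t:{0..x}|lborel. M * (b t * exp (2 * m t)))"
  proof (rule norm_set_integral_le[OF integrand_integrable[OF assms(1)]])
    show "set_integrable lborel {0..x} (\<lambda>t. M * (b t * exp (2 * m t)))"
      by (intro set_integrable_mult_right weight_integrable)
    fix t assume t: "t \<in> {0..x}"
    have "norm (A t (Y t)) \<le> b t * norm (Y t)" using t by (intro bound) auto
    also have "\<dots> \<le> b t * (M * exp (2 * m t))" using t b_nonneg by (intro mult_left_mono assms) auto
    finally show "norm (A t (Y t)) \<le> M * (b t * exp (2 * m t))" by (simp add: mult_ac)
  qed
  also have "\<dots> = M * ((exp (2 * m x) - 1) / 2)"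
    using weight_integral[OF assms(2)] by (simp only: set_integral_mult_right)
  finally show ?thesis .
qed

text \<open>Let the weighted norm of the difference attain its maximum \<open>M\<close> at
  \<open>s\<close>. There the difference has norm \<open>M * exp (2 * m s)\<close>, yet by the
  integral equation at most half of that, so \<open>M = 0\<close>.\<close>

theorem unique:
  assumes Y: "ac_from 0 Y (\<lambda>t. A t (Y t))" and Z: "ac_from 0 Z (\<lambda>t. A t (Z t))"
    and "Y 0 = Z 0" "0 \<le> X"
  shows "Y X = Z X"
proof -
  define D where "D = (\<lambda>t. Y t - Z t)"
  have D: "ac_from 0 D (\<lambda>t. A t (D t))"
    using ac_from_sub[OF Y Z] by (simp add: D_def linear_diff[OF linear])
  have cD: "continuous_on {0..x} D" for x
    using ac_from_continuous[OF D] by (rule continuous_on_subset) auto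
  have "continuous_on {0..X} (\<lambda>x. norm (D x) / exp (2 * m x))"
    by (intro continuous_intros cD continuous_on_subset[OF m_continuous]) auto
  then obtain s where s: "s \<in> {0..X}"
      "\<And>x. x \<in> {0..X} \<Longrightarrow> norm (D x) / exp (2 * m x) \<le> norm (D s) / exp (2 * m s)"
    using continuous_attains_sup[of "{0..X}" "\<lambda>x. norm (D x) / exp (2 * m x)"] \<open>0 \<le> X\<close>
    by (auto simp: Bex_def)
  define M where "M = norm (D s) / exp (2 * m s)"
  have M: "norm (D x) \<le> M * exp (2 * m x)" if "0 \<le> x" "x \<le> X" for x
    using s(2)[of x] that by (simp add: M_def[symmetric] field_simps)
  have M0: "M \<ge> 0" by (simp add: M_def)
  have "D s = (LINT t:{0..s}|lborel. A t (D t))"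
    using ac_from_diff[OF D order_refl, of s] s \<open>Y 0 = Z 0\<close> by (simp add: D_def)
  then have "norm (D s) \<le> M * ((exp (2 * m s) - 1) / 2)"
    using integral_weighted_bound[OF cD, of s M] s M by simp
  moreover have "norm (D s) = M * exp (2 * m s)" by (simp add: M_def)
  ultimately have "M * exp (2 * m s) \<le> - M" by (simp add: field_simps)
  moreover have "0 \<le> M * exp (2 * m s)" using M0 by simp
  ultimately have "M = 0" using M0 by linarith
  then show ?thesis using M[of X] \<open>0 \<le> X\<close> by (simp add: D_def)
qed

theorem exists:
  "\<exists>Y. Y 0 = Y0 \<and> ac_from 0 Y (\<lambda>t. A t (Y t))"
proof -
  \<comment> \<open>writing \<open>Y = exp (2 m) u\<close> turns the Picard map into a contraction on the whole half-line\<close>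
  define T where "T = (\<lambda>(u :: real \<Rightarrow>\<^sub>C 'v) x.
     exp (- (2 * m x)) *\<^sub>R (Y0 + (LINT t:{0..x}|lborel. A t (exp (2 * m t) *\<^sub>R u t))))"
  have c: "continuous_on S (\<lambda>t. exp (2 * m t) *\<^sub>R u t)" for u :: "real \<Rightarrow>\<^sub>C 'v" and S
    by (intro continuous_intros continuous_on_subset[OF m_continuous]) auto
  have m_nonneg: "0 \<le> m x" for x
    unfolding m_def set_lebesgue_integral_def
    by (rule Bochner_Integration.integral_nonneg) (auto simp: indicator_def intro: b_nonneg)
  \<comment> \<open>Applied twice: with \<open>M = norm u\<close> it shows that \<open>T u\<close>
    is bounded, and with \<open>M = dist u v\<close> that \<open>T\<close> contracts.\<close>
  have Tbound: "norm (exp (- (2 * m x)) *\<^sub>R (LINT t:{0..x}|lborel. A t (Y t))) \<le> M / 2"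
    if "continuous_on {0..x} Y" "0 \<le> M" "\<And>t. 0 \<le> t \<Longrightarrow> t \<le> x \<Longrightarrow> norm (Y t) \<le> M * exp (2 * m t)" for M x Y
  proof (cases "0 \<le> x")
    case True
    have "norm (LINT t:{0..x}|lborel. A t (Y t)) \<le> M * ((exp (2 * m x) - 1) / 2)"
      using that True by (intro integral_weighted_bound) auto
    also have "\<dots> \<le> exp (2 * m x) * (M / 2)"
      using that by (simp add: field_simps)
    finally show ?thesis by (simp add: exp_minus field_simps)
  qed (use that in \<open>simp add: set_lebesgue_integral_def\<close>)
  have bc: "T u \<in> bcontfun" for u
    unfolding bcontfun_def
  proof (intro CollectI conjI)
    show "continuous_on UNIV (T u)"
      unfolding T_def by (intro continuous_intros m_continuous continuous_LINT_Icc integrand_integrable c)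
    have "norm (T u x) \<le> norm Y0 + norm u / 2" for x
    proof -
      have "norm (T u x) \<le> norm (exp (- (2 * m x)) *\<^sub>R Y0)
          + norm (exp (- (2 * m x)) *\<^sub>R (LINT t:{0..x}|lborel. A t (exp (2 * m t) *\<^sub>R u t)))"
        unfolding T_def scaleR_add_right by (rule norm_triangle_ineq)
      also have "\<dots> \<le> norm Y0 + norm u / 2"
      proof (rule add_mono)
        show "norm (exp (- (2 * m x)) *\<^sub>R Y0) \<le> norm Y0"
          using m_nonneg[of x] by (simp add: mult_left_le_one_le)
        show "norm (exp (- (2 * m x)) *\<^sub>R (LINT t:{0..x}|lborel. A t (exp (2 * m t) *\<^sub>R u t))) \<le> norm u / 2"
          by (intro Tbound c) (auto simp: mult.commute intro!: mult_left_mono norm_bounded)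
      qed
      finally show ?thesis .
    qed
    then show "bounded (range (T u))" by (auto simp: bounded_iff)
  qed
  have app: "apply_bcontfun (Bcontfun (T u)) = T u" for u by (rule Bcontfun_inverse[OF bc])
  have "\<exists>!u. Bcontfun (T u) = u"
  proof (rule banach_fix_type[of "1/2"])
    show "\<forall>u v. dist (Bcontfun (T u)) (Bcontfun (T v)) \<le> 1/2 * dist u v"
    proof (intro allI dist_bound)
      fix u v :: "real \<Rightarrow>\<^sub>C 'v" and x
      have "T u x - T v x = exp (- (2 * m x)) *\<^sub>R
          ((LINT t:{0..x}|lborel. A t (exp (2 * m t) *\<^sub>R u t)) - (LINT t:{0..x}|lborel. A t (exp (2 * m t) *\<^sub>R v t)))"
        by (simp add: T_def algebra_simps)
      also have "(LINT t:{0..x}|lborel. A t (exp (2 * m t) *\<^sub>R u t)) - (LINT t:{0..x}|lborel. A t (exp (2 * m t) *\<^sub>R v t))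
         = (LINT t:{0..x}|lborel. A t (exp (2 * m t) *\<^sub>R u t) - A t (exp (2 * m t) *\<^sub>R v t))"
        by (intro set_integral_diff(2)[symmetric] integrand_integrable c)
      also have "\<dots> = (LINT t:{0..x}|lborel. A t (exp (2 * m t) *\<^sub>R u t - exp (2 * m t) *\<^sub>R v t))"
        by (simp add: linear_diff[OF linear])
      finally have *: "T u x - T v x = exp (- (2 * m x)) *\<^sub>R
          (LINT t:{0..x}|lborel. A t (exp (2 * m t) *\<^sub>R u t - exp (2 * m t) *\<^sub>R v t))" .
      have "norm (T u x - T v x) \<le> dist u v / 2"
        unfolding *
      proof (intro Tbound continuous_on_diff c)
        fix t
        have "norm (exp (2 * m t) *\<^sub>R u t - exp (2 * m t) *\<^sub>R v t) = exp (2 * m t) * dist (u t) (v t)"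
          by (simp add: scaleR_diff_right[symmetric] dist_norm)
        also have "\<dots> \<le> exp (2 * m t) * dist u v" by (intro mult_left_mono dist_bounded) auto
        finally show "norm (exp (2 * m t) *\<^sub>R u t - exp (2 * m t) *\<^sub>R v t) \<le> dist u v * exp (2 * m t)"
          by (simp add: mult.commute)
      qed auto
      then show "dist (Bcontfun (T u) x) (Bcontfun (T v) x) \<le> 1/2 * dist u v"
        by (simp add: app dist_norm)
    qed
  qed auto
  then obtain u where "Bcontfun (T u) = u" by blast
  then have u: "T u x = u x" for x by (metis app)
  define Y where "Y = (\<lambda>x. exp (2 * m x) *\<^sub>R u x)"
  have Y: "Y x = Y0 + (LINT t:{0..x}|lborel. A t (Y t))" for x
    using u[of x, symmetric] by (simp add: Y_def T_def exp_minus)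
  have "ac_from 0 Y (\<lambda>t. A t (Y t))"
    by (rule ac_from_I[OF _ Y]) (unfold Y_def, intro integrand_integrable c)
  moreover have "Y 0 = Y0" using Y[of 0] LINT_singleton[of 0 "\<lambda>t. A t (Y t)"] by simp
  ultimately show ?thesis by blast
qed

end

lemma ac_from_Pair:
  fixes F :: "real \<Rightarrow> 'a::euclidean_space" and G :: "real \<Rightarrow> 'b::euclidean_space"
  shows "ac_from a (\<lambda>x. (F x, G x)) (\<lambda>x. (f x, g x)) \<longleftrightarrow> ac_from a F f \<and> ac_from a G g"
proof safe
  assume "ac_from a (\<lambda>x. (F x, G x)) (\<lambda>x. (f x, g x))"
  from ac_from_bounded_linear[OF bounded_linear_fst this] ac_from_bounded_linear[OF bounded_linear_snd this]
  show "ac_from a F f" "ac_from a G g" by simp_all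
next
  assume *: "ac_from a F f" "ac_from a G g"
  have "bounded_linear (\<lambda>u::'a. (u, 0::'b))" "bounded_linear (\<lambda>v::'b. (0::'a, v))"
    by (intro bounded_linear_Pair bounded_linear_ident bounded_linear_zero)+
  from ac_from_add[OF ac_from_bounded_linear[OF this(1) *(1)] ac_from_bounded_linear[OF this(2) *(2)]]
  show "ac_from a (\<lambda>x. (F x, G x)) (\<lambda>x. (f x, g x))" by simp
qed

text \<open>\<open>ode_solution\<close> hides the quasi-derivative behind an existential quantifier.
  Here it is an argument, because initial data, Wronskians and amplitudes all involve it.\<close>

definition sl_solution ::
  "(real \<Rightarrow> real) \<Rightarrow> (real \<Rightarrow> real) \<Rightarrow> complex \<Rightarrow> (real \<Rightarrow> complex) \<Rightarrow> (real \<Rightarrow> complex) \<Rightarrow> bool" where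
  "sl_solution p q z f g \<longleftrightarrow>
     ac_from 0 f (\<lambda>t. g t / complex_of_real (p t)) \<and> ac_from 0 g (\<lambda>t. (complex_of_real (q t) - z) * f t)"

lemma ode_solution_iff: "ode_solution p q z f \<longleftrightarrow> (\<exists>g. sl_solution p q z f g)"
  unfolding ode_solution_def sl_solution_def ac_from_def by (intro arg_cong[where f=Ex] ext) blast

lemma sl_solution_lincomb:
  assumes "sl_solution p q z f1 g1" "sl_solution p q z f2 g2"
  shows "sl_solution p q z (\<lambda>x. \<alpha> * f1 x + \<beta> * f2 x) (\<lambda>x. \<alpha> * g1 x + \<beta> * g2 x)"
  unfolding sl_solution_def
proof
  show "ac_from 0 (\<lambda>x. \<alpha> * f1 x + \<beta> * f2 x) (\<lambda>t. (\<alpha> * g1 t + \<beta> * g2 t) / complex_of_real (p t))"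
    using ac_from_add[OF ac_from_cmult ac_from_cmult, of 0 f1 _ f2 _ \<alpha> \<beta>] assms
    by (force simp: sl_solution_def add_divide_distrib)
  show "ac_from 0 (\<lambda>x. \<alpha> * g1 x + \<beta> * g2 x) (\<lambda>t. (complex_of_real (q t) - z) * (\<alpha> * f1 t + \<beta> * f2 t))"
    using ac_from_add[OF ac_from_cmult ac_from_cmult, of 0 g1 _ g2 _ \<alpha> \<beta>] assms
    by (force simp: sl_solution_def algebra_simps)
qed

lemma sl_solution_cnj:
  assumes "sl_solution p q z f g"
  shows "sl_solution p q (cnj z) (\<lambda>x. cnj (f x)) (\<lambda>x. cnj (g x))"
  using assms ac_from_cnj[of 0 f] ac_from_cnj[of 0 g] by (force simp: sl_solution_def)

text \<open>In the product rule the terms with \<open>q - z\<close> cancel each other, and so do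
  those with \<open>g1 * g2 / p\<close>.\<close>

lemma wronskian_const:
  assumes 1: "sl_solution p q z f1 g1" and 2: "sl_solution p q z f2 g2" and "0 \<le> x"
  shows "g1 x * f2 x - f1 x * g2 x = g1 0 * f2 0 - f1 0 * g2 0"
proof -
  have "ac_from 0 (\<lambda>x. g1 x * f2 x - f1 x * g2 x) (\<lambda>x. 0)"
  proof (rule ac_from_cong)
    show "ac_from 0 (\<lambda>x. g1 x * f2 x - f1 x * g2 x)
       (\<lambda>t. ((complex_of_real (q t) - z) * f1 t * f2 t + g1 t * (g2 t / complex_of_real (p t)))
          - (g1 t / complex_of_real (p t) * g2 t + f1 t * ((complex_of_real (q t) - z) * f2 t)))"
      using 1 2 by (intro ac_from_sub ac_from_mult) (auto simp: sl_solution_def)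
  qed (auto simp: algebra_simps)
  from ac_from_diff[OF this order_refl \<open>0 \<le> x\<close>] show ?thesis by simp
qed

locale sl_coeffs =
  fixes p q :: "real \<Rightarrow> real"
  assumes p_pos: "\<And>x. 0 \<le> x \<Longrightarrow> 0 < p x" and p_cont: "continuous_on {0..} p"
    and q_int: "\<And>x. 0 \<le> x \<Longrightarrow> set_integrable lborel {0..x} q"
begin

lemma linear_ode: "linear_ode
   (\<lambda>t (u, v). (v / complex_of_real (p t), (complex_of_real (q t) - z) * u))
   (\<lambda>t. 1 / p t + cmod (complex_of_real (q t) - z))"
proof
  fix t :: real
  show "(case r *\<^sub>R x of (u, v) \<Rightarrow> (v / complex_of_real (p t), (complex_of_real (q t) - z) * u)) =
         r *\<^sub>R (case x of (u, v) \<Rightarrow> (v / complex_of_real (p t), (complex_of_real (q t) - z) * u))" for r x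
    by (auto simp: split_beta scaleR_conv_of_real)
  show "(case x + y of (u, v) \<Rightarrow> (v / complex_of_real (p t), (complex_of_real (q t) - z) * u)) =
         (case x of (u, v) \<Rightarrow> (v / complex_of_real (p t), (complex_of_real (q t) - z) * u)) +
         (case y of (u, v) \<Rightarrow> (v / complex_of_real (p t), (complex_of_real (q t) - z) * u))" for x y
    by (auto simp: split_beta add_divide_distrib distrib_left)
  assume t: "0 \<le> t"
  note p = p_pos[OF t]
  show "0 \<le> 1 / p t + cmod (complex_of_real (q t) - z)" using p by auto
  show "norm (case v of (u, v) \<Rightarrow> (v / complex_of_real (p t), (complex_of_real (q t) - z) * u))
      \<le> (1 / p t + cmod (complex_of_real (q t) - z)) * norm v" for v :: "complex \<times> complex"
  proof (cases v)
    case (Pair a c)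
    have "norm (c / complex_of_real (p t), (complex_of_real (q t) - z) * a)
       \<le> norm (c / complex_of_real (p t)) + norm ((complex_of_real (q t) - z) * a)"
      by (rule norm_Pair_le)
    also have "\<dots> = 1 / p t * norm c + cmod (complex_of_real (q t) - z) * norm a"
      using p by (simp add: norm_mult norm_divide)
    also have "\<dots> \<le> 1 / p t * norm v + cmod (complex_of_real (q t) - z) * norm v"
      using p norm_fst_le[of a c] norm_snd_le[of c a] Pair
      by (intro add_mono mult_left_mono) auto
    finally show ?thesis using Pair by (simp add: algebra_simps)
  qed
next
  fix x :: real assume x: "0 \<le> x"
  have "continuous_on {0..x} (\<lambda>t. 1 / p t)"
    using p_pos by (intro continuous_intros continuous_on_subset[OF p_cont]) force+
  then have 1: "set_integrable lborel {0..x} (\<lambda>t. 1 / p t)"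
    by (rule borel_integrable_atLeastAtMost')
  have 2: "set_integrable lborel {0..x} (\<lambda>t. complex_of_real (q t) - z)"
  proof (intro set_integral_diff)
    show "set_integrable lborel {0..x} (\<lambda>t. complex_of_real (q t))"
      by (rule set_integrable_of_real[OF q_int[OF x]])
    show "set_integrable lborel {0..x} (\<lambda>t. z)"
      by (rule borel_integrable_atLeastAtMost') auto
  qed
  show "set_integrable lborel {0..x} (\<lambda>t. 1 / p t + cmod (complex_of_real (q t) - z))"
    by (intro set_integral_add 1 set_integrable_norm[OF 2])
next
  fix Y :: "real \<Rightarrow> complex \<times> complex" and x :: real
  assume Y: "continuous_on {0..x} Y"
  have q: "(\<lambda>t. complex_of_real (indicator {0..x} t *\<^sub>R q t)) \<in> borel_measurable lborel"
  proof (cases "0 \<le> x")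
    case True
    from borel_measurable_integrable[OF q_int[OF True, unfolded set_integrable_def]]
    show ?thesis
      by (rule measurable_compose[OF _ borel_measurable_continuous_onI]) (intro continuous_intros)
  qed auto
  have p: "continuous_on {0..x} p" using p_cont by (rule continuous_on_subset) auto
  have c1: "continuous_on {0..x} (\<lambda>t. snd (Y t) / complex_of_real (p t))"
    using p_pos by (intro continuous_intros Y p) force
  have c2: "continuous_on {0..x} (\<lambda>t. fst (Y t))" by (intro continuous_intros Y)
  have c3: "continuous_on {0..x} (\<lambda>t. z * fst (Y t))" by (intro continuous_intros Y)
  \<comment> \<open>\<open>q\<close> is known to be measurable only on \<open>{0..x}\<close>, so the
    indicator is distributed over the individual factors.\<close>
  have "(\<lambda>t. (indicator {0..x} t *\<^sub>R (snd (Y t) / complex_of_real (p t)),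
       complex_of_real (indicator {0..x} t *\<^sub>R q t) * (indicator {0..x} t *\<^sub>R fst (Y t))
        - indicator {0..x} t *\<^sub>R (z * fst (Y t)))) \<in> borel_measurable lborel"
    using set_measurable_of_continuous[OF c1] set_measurable_of_continuous[OF c2]
      set_measurable_of_continuous[OF c3]
    unfolding set_borel_measurable_def
    by (intro borel_measurable_Pair borel_measurable_diff borel_measurable_times q)
  also have "(\<lambda>t. (indicator {0..x} t *\<^sub>R (snd (Y t) / complex_of_real (p t)),
       complex_of_real (indicator {0..x} t *\<^sub>R q t) * (indicator {0..x} t *\<^sub>R fst (Y t))
        - indicator {0..x} t *\<^sub>R (z * fst (Y t))))
     = (\<lambda>t. indicator {0..x} t *\<^sub>R (case Y t of (u, v) \<Rightarrow> (v / complex_of_real (p t), (complex_of_real (q t) - z) * u)))"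
    by (auto simp: fun_eq_iff indicator_def split_beta algebra_simps)
  finally show "set_borel_measurable lborel {0..x}
      (\<lambda>t. case Y t of (u, v) \<Rightarrow> (v / complex_of_real (p t), (complex_of_real (q t) - z) * u))"
    by (simp add: set_borel_measurable_def)
qed

lemma sl_solution_exists: "\<exists>f g. sl_solution p q z f g \<and> f 0 = u \<and> g 0 = v"
proof -
  interpret linear_ode "\<lambda>t (u, v). (v / complex_of_real (p t), (complex_of_real (q t) - z) * u)"
    "\<lambda>t. 1 / p t + cmod (complex_of_real (q t) - z)" by (rule linear_ode)
  from exists[of "(u, v)"] obtain Y where Y: "Y 0 = (u, v)"
    "ac_from 0 Y (\<lambda>t. case Y t of (u, v) \<Rightarrow> (v / complex_of_real (p t), (complex_of_real (q t) - z) * u))"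
    by blast
  have "sl_solution p q z (\<lambda>t. fst (Y t)) (\<lambda>t. snd (Y t))"
    unfolding sl_solution_def ac_from_Pair[symmetric] using Y(2) by (simp add: split_beta)
  moreover have "fst (Y 0) = u" "snd (Y 0) = v" using Y(1) by auto
  ultimately show ?thesis by blast
qed

lemma sl_solution_unique:
  assumes "sl_solution p q z f1 g1" "sl_solution p q z f2 g2" "f1 0 = f2 0" "g1 0 = g2 0" "0 \<le> x"
  shows "f1 x = f2 x" "g1 x = g2 x"
proof -
  interpret linear_ode "\<lambda>t (u, v). (v / complex_of_real (p t), (complex_of_real (q t) - z) * u)"
    "\<lambda>t. 1 / p t + cmod (complex_of_real (q t) - z)" by (rule linear_ode)
  from unique[of "\<lambda>t. (f1 t, g1 t)" "\<lambda>t. (f2 t, g2 t)" x] assms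
  show "f1 x = f2 x" "g1 x = g2 x" by (simp_all add: sl_solution_def ac_from_Pair)
qed

end

section \<open>Amplitudes near infinity\<close>

lemma LINT_Ici_split:
  fixes f :: "real \<Rightarrow> 'a::euclidean_space"
  assumes i: "set_integrable lborel {a..} f" and "a \<le> x"
  shows "(LINT t:{a..}|lborel. f t) = (LINT t:{a..x}|lborel. f t) + (LINT t:{x..}|lborel. f t)"
proof -
  have ix: "set_integrable lborel {x..} f" using i by (rule set_integrable_subset) (use assms in auto)
  have "((\<lambda>b. (LINT t:{a..x}|lborel. f t) + (LINT t:{x..b}|lborel. f t))
      \<longlongrightarrow> (LINT t:{a..x}|lborel. f t) + (LINT t:{x..}|lborel. f t)) at_top"
    by (intro tendsto_intros tendsto_set_lebesgue_integral_at_top ix) auto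
  moreover have "\<forall>\<^sub>F b in at_top. (LINT t:{a..x}|lborel. f t) + (LINT t:{x..b}|lborel. f t) = (LINT t:{a..b}|lborel. f t)"
    using eventually_ge_at_top[of x]
  proof eventually_elim
    case (elim b)
    have "set_integrable lborel {a..b} f" using i by (rule set_integrable_subset) auto
    then show ?case using LINT_Icc_combine[of a x b f] elim assms by simp
  qed
  ultimately have "((\<lambda>b. LINT t:{a..b}|lborel. f t)
      \<longlongrightarrow> (LINT t:{a..x}|lborel. f t) + (LINT t:{x..}|lborel. f t)) at_top"
    by (rule Lim_transform_eventually)
  moreover have "((\<lambda>b. LINT t:{a..b}|lborel. f t) \<longlongrightarrow> (LINT t:{a..}|lborel. f t)) at_top"
    by (intro tendsto_set_lebesgue_integral_at_top i) auto
  ultimately show ?thesis using tendsto_unique[OF trivial_limit_at_top_linorder] by blast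
qed

text \<open>The distance to the limit is exactly a tail integral of the density; the rate O(eps) of
  the amplitudes originates here.\<close>

lemma ac_from_limit:
  assumes F: "ac_from a F f" and i: "set_integrable lborel {a..} f"
  obtains L where "(F \<longlongrightarrow> L) at_top" "\<And>x. a \<le> x \<Longrightarrow> L - F x = (LINT t:{x..}|lborel. f t)"
proof (rule that[of "F a + (LINT t:{a..}|lborel. f t)"])
  have "((\<lambda>x. F a + (LINT t:{a..x}|lborel. f t)) \<longlongrightarrow> F a + (LINT t:{a..}|lborel. f t)) at_top"
    by (intro tendsto_intros tendsto_set_lebesgue_integral_at_top i) auto
  moreover have "\<forall>\<^sub>F x in at_top. F a + (LINT t:{a..x}|lborel. f t) = F x"
    using eventually_ge_at_top[of a] by eventually_elim (simp add: ac_from_D(2)[OF F, symmetric])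
  ultimately show "(F \<longlongrightarrow> F a + (LINT t:{a..}|lborel. f t)) at_top"
    by (rule Lim_transform_eventually)
  show "F a + (LINT t:{a..}|lborel. f t) - F x = (LINT t:{x..}|lborel. f t)" if "a \<le> x" for x
    using LINT_Ici_split[OF i that] ac_from_diff[OF F order_refl that] by (simp add: algebra_simps)
qed

lemma set_borel_measurable_Ici:
  fixes f :: "real \<Rightarrow> 'a::euclidean_space"
  assumes "\<And>x. a \<le> x \<Longrightarrow> set_borel_measurable lborel {a..x} f"
  shows "set_borel_measurable lborel {a..} f"
  unfolding set_borel_measurable_def
proof (rule borel_measurable_LIMSEQ_metric)
  show "(\<lambda>x. indicator {a..a + real n} x *\<^sub>R f x) \<in> borel_measurable lborel" for n
    using assms[of "a + real n"] by (simp add: set_borel_measurable_def)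
  fix x :: real
  obtain N where "x - a \<le> real N" using real_arch_simple by blast
  then have "\<forall>\<^sub>F n in sequentially. indicator {a..} x *\<^sub>R f x = indicator {a..a + real n} x *\<^sub>R f x"
    by (intro eventually_sequentiallyI[of N]) (auto simp: indicator_def)
  then show "(\<lambda>n. indicator {a..a + real n} x *\<^sub>R f x) \<longlonglongrightarrow> indicator {a..} x *\<^sub>R f x"
    by (rule Lim_transform_eventually[OF tendsto_const])
qed

lemma set_integrable_Ici_dominated:
  fixes f :: "real \<Rightarrow> 'a::euclidean_space"
  assumes "\<And>x. a \<le> x \<Longrightarrow> set_integrable lborel {a..x} f" "set_integrable lborel {a..} v"
    "\<And>x. a \<le> x \<Longrightarrow> norm (f x) \<le> v x"
  shows "set_integrable lborel {a..} f"
  using assms(2)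
proof (rule set_integrable_bound)
  show "set_borel_measurable lborel {a..} f"
    using assms(1) by (intro set_borel_measurable_Ici)
      (auto simp: set_borel_measurable_def set_integrable_def intro: borel_measurable_integrable)
  show "AE x in lborel. x \<in> {a..} \<longrightarrow> norm (f x) \<le> norm (v x)"
    using assms(3) by (force intro: AE_I2)
qed

lemma ac_from_cis:
  assumes "ac_from a \<Theta> \<theta>"
  shows "ac_from a (\<lambda>x. cis (\<Theta> x)) (\<lambda>x. \<i> * complex_of_real (\<theta> x) * cis (\<Theta> x))"
proof -
  have 1: "ac_from a (\<lambda>x. cos (\<Theta> x)) (\<lambda>x. - sin (\<Theta> x) * \<theta> x)"
    by (rule ac_from_chain[OF assms, where I = UNIV]) (auto intro!: derivative_eq_intros continuous_intros)
  have 2: "ac_from a (\<lambda>x. sin (\<Theta> x)) (\<lambda>x. cos (\<Theta> x) * \<theta> x)"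
    by (rule ac_from_chain[OF assms, where I = UNIV]) (auto intro!: derivative_eq_intros continuous_intros)
  show ?thesis
    by (rule ac_from_cong[OF ac_from_add[OF ac_from_of_real[OF 1] ac_from_cmult[OF ac_from_of_real[OF 2], of \<i>]]])
      (auto simp: complex_eq_iff)
qed

lemma pos_part_nonneg_id: "0 \<le> u \<Longrightarrow> pos_part u = u" and pos_part_nonpos: "u \<le> 0 \<Longrightarrow> pos_part u = 0"
  by (auto simp: pos_part_def)

locale jost_setting =
  fixes p p' q q' :: "real \<Rightarrow> real" and p0 x0 lam :: real
  assumes A: "assumption_A p p' p0 q q' x0" and lam: "0 < lam"
begin

abbreviation eps :: "real \<Rightarrow> real" where "eps \<equiv> eps_fun p' q' x0"

abbreviation Phi :: "real \<Rightarrow> real" where "Phi x \<equiv> Phi_fun p q x lam"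

lemma p_pos: "0 \<le> x \<Longrightarrow> 0 < p x" and p'_int: "set_integrable lborel {0..} p'"
  and p_lim: "(p \<longlongrightarrow> p0) at_top" and p0: "0 < p0" and x0: "0 \<le> x0"
  and q'_int: "set_integrable lborel {x0..} q'" and q_lim: "(q \<longlongrightarrow> 0) at_top"
  and q_int0: "set_integrable lborel {0..x0} q"
  using A unfolding assumption_A_def by blast+

lemma p_ac: "ac_from 0 p p'"
proof (rule ac_from_I)
  show "p x = p 0 + (LINT t:{0..x}|lborel. p' t)" if "0 \<le> x" for x
    using A that unfolding assumption_A_def by blast
qed (rule set_integrable_subset[OF p'_int], auto)

lemma q_ac: "ac_from x0 q q'"
proof (rule ac_from_I)
  show "q x = q x0 + (LINT t:{x0..x}|lborel. q' t)" if "x0 \<le> x" for x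
    using A that unfolding assumption_A_def by blast
qed (rule set_integrable_subset[OF q'_int], auto)

sublocale sl_coeffs p q
proof
  show "continuous_on {0..} p" by (rule ac_from_continuous[OF p_ac])
  fix x :: real assume "0 \<le> x"
  have "continuous_on {x0..x} q"
    using ac_from_continuous[OF q_ac] by (rule continuous_on_subset) auto
  then have "set_integrable lborel {x0..x} q" by (rule borel_integrable_atLeastAtMost')
  then have "set_integrable lborel {0..max x x0} q"
    using q_int0 by (cases "x0 \<le> x") (auto intro: set_integrable_Icc_combine simp: max_def)
  then show "set_integrable lborel {0..x} q"
    by (rule set_integrable_subset) auto
qed (rule p_pos)

text \<open>The integrand of \<open>eps_fun\<close>. Derivatives of the auxiliary functions are
  bounded by multiples of it, so that their tail integrals are O(eps).\<close>

definition v :: "real \<Rightarrow> real" where "v y = \<bar>p' y\<bar> + indicator {x0..} y * \<bar>q' y\<bar>"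

lemma v_nonneg: "0 \<le> v y" by (simp add: v_def)

lemma v_eq: "x0 \<le> y \<Longrightarrow> v y = \<bar>p' y\<bar> + \<bar>q' y\<bar>" by (simp add: v_def)

lemma eps_eq: "eps x = (LINT y:{x..}|lborel. v y)"
  by (simp add: eps_fun_def v_def)

lemma v_int: "set_integrable lborel {x0..} v"
proof -
  have "set_integrable lborel {x0..} (\<lambda>y. \<bar>p' y\<bar> + \<bar>q' y\<bar>)"
    by (intro set_integral_add set_integrable_abs q'_int set_integrable_subset[OF p'_int]) (use x0 in auto)
  then show ?thesis by (rule iffD1[OF set_integrable_cong, rotated -1]) (auto simp: v_eq)
qed

lemma eps_nonneg: "0 \<le> eps x"
  unfolding eps_eq set_lebesgue_integral_def
  by (rule Bochner_Integration.integral_nonneg) (simp add: v_nonneg)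

lemma eps_tendsto_0: "(eps \<longlongrightarrow> 0) at_top"
proof -
  have "ac_from x0 (\<lambda>x. 0 + (LINT t:{x0..x}|lborel. v t)) v"
    by (rule ac_from_indefinite_integral, rule set_integrable_subset[OF v_int]) auto
  from ac_from_limit[OF this v_int] obtain L where
    L: "((\<lambda>x. 0 + (LINT t:{x0..x}|lborel. v t)) \<longlongrightarrow> L) at_top"
      "\<And>x. x0 \<le> x \<Longrightarrow> L - (0 + (LINT t:{x0..x}|lborel. v t)) = (LINT t:{x..}|lborel. v t)" by blast
  have "((\<lambda>x. L - (0 + (LINT t:{x0..x}|lborel. v t))) \<longlongrightarrow> L - L) at_top"
    by (intro tendsto_diff L tendsto_const)
  moreover have "\<forall>\<^sub>F x in at_top. L - (0 + (LINT t:{x0..x}|lborel. v t)) = eps x"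
    using eventually_ge_at_top[of x0] by eventually_elim (simp only: L(2) eps_eq)
  ultimately have "(eps \<longlongrightarrow> L - L) at_top" by (rule Lim_transform_eventually)
  then show ?thesis by simp
qed

lemma integral_tail_le_eps:
  fixes f :: "real \<Rightarrow> 'a::euclidean_space"
  assumes "x0 \<le> x" "set_integrable lborel {x..} f" "\<And>y. x \<le> y \<Longrightarrow> norm (f y) \<le> C * v y"
  shows "norm (LINT y:{x..}|lborel. f y) \<le> C * eps x"
proof -
  have "norm (LINT y:{x..}|lborel. f y) \<le> (LINT y:{x..}|lborel. C * v y)"
    using assms by (intro norm_set_integral_le set_integrable_mult_right set_integrable_subset[OF v_int]) auto
  then show ?thesis by (simp add: eps_eq)
qed

text \<open>\<open>c = 1\<close> gives the integrand of \<open>Phi_fun\<close>, and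
  \<open>c = -1\<close> the one in the exponent of \<open>K_fun\<close>. As \<open>q\<close> may be
  unbounded, the root is dominated by \<open>1 + \<bar>u\<bar>\<close>, which is integrable on
  compact intervals.\<close>

lemma sqrt_pos_part_integrable:
  assumes "0 \<le> x" "c = 1 \<or> c = -1"
  shows "set_integrable lborel {0..x} (\<lambda>y. sqrt (pos_part (c * (lam - q y) / p y)))"
proof -
  have pc: "continuous_on {0..x} p" using p_cont by (rule continuous_on_subset) auto
  have ipc: "continuous_on {0..x} (\<lambda>t. 1 / p t)"
    using p_pos by (intro continuous_intros pc) force
  have il: "set_integrable lborel {0..x} (\<lambda>t. c * (lam - q t))"
    by (intro set_integrable_mult_right set_integral_diff q_int assms borel_integrable_atLeastAtMost') auto
  have i: "set_integrable lborel {0..x} (\<lambda>t. c * (lam - q t) * (1 / p t))"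
    by (rule set_integrable_mult_continuous[OF il ipc])
  have i': "set_integrable lborel {0..x} (\<lambda>t. 1 + \<bar>c * (lam - q t) * (1 / p t)\<bar>)"
    by (intro set_integral_add set_integrable_abs i borel_integrable_atLeastAtMost') auto
  show ?thesis
  proof (rule set_integrable_bound[OF i'])
    have "(\<lambda>t. sqrt (pos_part (indicator {0..x} t *\<^sub>R (c * (lam - q t) * (1 / p t))))) \<in> borel_measurable lborel"
      by (rule measurable_compose[OF borel_measurable_integrable[OF i[unfolded set_integrable_def]]])
        (auto simp: pos_part_def)
    also have "(\<lambda>t. sqrt (pos_part (indicator {0..x} t *\<^sub>R (c * (lam - q t) * (1 / p t)))))
       = (\<lambda>t. indicator {0..x} t *\<^sub>R sqrt (pos_part (c * (lam - q t) / p t)))"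
      by (auto simp: indicator_def pos_part_def fun_eq_iff)
    finally show "set_borel_measurable lborel {0..x} (\<lambda>y. sqrt (pos_part (c * (lam - q y) / p y)))"
      by (simp add: set_borel_measurable_def)
    have le: "sqrt (pos_part u) \<le> 1 + \<bar>u\<bar>" for u
    proof -
      have "pos_part u \<le> 1 + \<bar>u\<bar>" by (auto simp: pos_part_def)
      also have "\<dots> \<le> (1 + \<bar>u\<bar>)\<^sup>2" by (rule self_le_power) auto
      finally have "pos_part u \<le> (1 + \<bar>u\<bar>)\<^sup>2" .
      then show ?thesis by (intro real_le_lsqrt) (auto simp: pos_part_def)
    qed
    have nn: "0 \<le> sqrt (pos_part u)" for u by (simp add: pos_part_def)
    have "norm (sqrt (pos_part (c * (lam - q t) / p t))) \<le> norm (1 + \<bar>c * (lam - q t) * (1 / p t)\<bar>)" for t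
      using le[of "c * (lam - q t) / p t"] nn[of "c * (lam - q t) / p t"] by simp
    then show "AE t in lborel. t \<in> {0..x} \<longrightarrow>
       norm (sqrt (pos_part (c * (lam - q t) / p t))) \<le> norm (1 + \<bar>c * (lam - q t) * (1 / p t)\<bar>)"
      by (intro AE_I2) blast
  qed
qed

lemma Phi_ac: "ac_from 0 Phi (\<lambda>y. sqrt (pos_part ((lam - q y) / p y)))"
  using sqrt_pos_part_integrable[of _ 1] by (intro ac_from_I[where c=0]) (auto simp: Phi_fun_def)

text \<open>\<open>cp\<close> and \<open>cm\<close> are the limit amplitudes of the waves with
  phases \<open>Phi\<close> and \<open>- Phi\<close>. The quasi-derivative is recorded along with
  \<open>f\<close> because the Wronskian at infinity needs both.\<close>

definition asym :: "(real \<Rightarrow> complex) \<Rightarrow> (real \<Rightarrow> complex) \<Rightarrow> complex \<Rightarrow> complex \<Rightarrow> bool" where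
  "asym f g cp cm \<longleftrightarrow> (\<exists>C. \<forall>\<^sub>F x in at_top.
     cmod (f x - (cp * cis (Phi x) + cm * cis (- Phi x))) \<le> C * eps x \<and>
     cmod (g x / complex_of_real (sqrt (p x * (lam - q x))) - \<i> * (cp * cis (Phi x) - cm * cis (- Phi x))) \<le> C * eps x)"

end

text \<open>Beyond \<open>x1\<close> both \<open>lam - q\<close> and \<open>p\<close> stay within a
  factor 2 of their limits. The last condition makes the total variation of
  \<open>p (lam - q)\<close> beyond \<open>x1\<close> so small that the energy can at most
  double.\<close>

locale jost_tail = jost_setting +
  fixes x1 :: real
  assumes x1: "x0 \<le> x1"
    and tail_q: "\<And>x. x1 \<le> x \<Longrightarrow> lam / 2 \<le> lam - q x \<and> lam - q x \<le> 2 * lam"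
    and tail_p: "\<And>x. x1 \<le> x \<Longrightarrow> p0 / 2 \<le> p x \<and> p x \<le> 2 * p0"
    and tail_eps: "(2 * lam + 2 * p0) * eps x1 \<le> p0 * lam / 8"
begin

definition S :: "real \<Rightarrow> real" where "S x = p x * (lam - q x)"
definition S' :: "real \<Rightarrow> real" where "S' x = p' x * (lam - q x) + p x * (- q' x)"
text \<open>\<delta> is the product of the lower bounds \<open>p0 / 2\<close> and
  \<open>lam / 2\<close> of the two factors of \<open>S\<close>; \<open>B\<close> exceeds both of
  their upper bounds. In these terms \<open>tail_eps\<close> says
  \<open>B * eps x1 \<le> \<delta> / 2\<close>.\<close>

definition \<delta> where "\<delta> = p0 * lam / 4"
definition B where "B = 2 * lam + 2 * p0"

lemma \<delta>: "0 < \<delta>" using p0 lam by (simp add: \<delta>_def)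
lemma B: "0 < B" using p0 lam by (simp add: B_def)
lemma x1_nonneg: "0 \<le> x1" using x0 x1 by simp

lemma S_lower: "x1 \<le> x \<Longrightarrow> \<delta> \<le> S x"
  using tail_q[of x] tail_p[of x] mult_mono[of "p0/2" "p x" "lam/2" "lam - q x"] p0 lam
  by (simp add: \<delta>_def S_def)

lemma S_ac: "ac_from x1 S S'"
proof -
  have "ac_from x1 q q'" by (rule ac_from_mono[OF q_ac x1])
  then have "ac_from x1 (\<lambda>x. lam - q x) (\<lambda>x. - q' x)" using ac_from_sub[OF ac_from_const] by force
  from ac_from_mult[OF ac_from_mono[OF p_ac x1_nonneg] this]
  show ?thesis by (simp add: S_def[abs_def] S'_def[abs_def])
qed

lemma S'_bound: assumes "x1 \<le> x" shows "\<bar>S' x\<bar> \<le> B * v x"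
proof -
  have "\<bar>S' x\<bar> \<le> \<bar>p' x\<bar> * \<bar>lam - q x\<bar> + \<bar>p x\<bar> * \<bar>q' x\<bar>"
    unfolding S'_def by (rule order_trans[OF abs_triangle_ineq]) (simp add: abs_mult)
  also have "\<dots> \<le> \<bar>p' x\<bar> * B + B * \<bar>q' x\<bar>"
    using tail_q[OF assms] tail_p[OF assms] p0 lam
    by (intro add_mono mult_left_mono mult_right_mono) (auto simp: B_def)
  finally show ?thesis using x1 assms by (simp add: v_eq algebra_simps)
qed

lemma v_int1: "x1 \<le> x \<Longrightarrow> set_integrable lborel {x..} v"
  using v_int by (rule set_integrable_subset) (use x1 in auto)

text \<open>On the tail this is \<open>1 / (p k)\<close>, where \<open>k\<close> is the wave number,
  that is, the derivative of \<open>Phi\<close>. Hence \<open>g * r\<close> stands for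
  \<open>f' / k\<close>.\<close>

definition r :: "real \<Rightarrow> real" where "r x = 1 / sqrt (S x)"
definition r' :: "real \<Rightarrow> real" where "r' x = - (1 / (2 * S x * sqrt (S x))) * S' x"
definition k :: "real \<Rightarrow> real" where "k x = sqrt (pos_part ((lam - q x) / p x))"

lemma r_ac: "ac_from x1 r r'"
  unfolding r_def[abs_def] r'_def[abs_def]
proof (rule ac_from_chain[OF S_ac, where I = "{\<delta>..}" and h = "\<lambda>u. 1 / sqrt u" and h' = "\<lambda>u. - (1 / (2 * u * sqrt u))"])
  show "((\<lambda>u. 1 / sqrt u) has_real_derivative - (1 / (2 * u * sqrt u))) (at u)" if "u \<in> {\<delta>..}" for u
    using that \<delta> by (auto intro!: derivative_eq_intros simp: field_simps)
  show "continuous_on {\<delta>..} (\<lambda>u. - (1 / (2 * u * sqrt u)))"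
    using \<delta> by (intro continuous_intros) auto
qed (auto simp: S_lower)

lemma r'_bound: assumes "x1 \<le> x" shows "\<bar>r' x\<bar> \<le> B / (2 * \<delta> * sqrt \<delta>) * v x"
proof -
  have "2 * \<delta> * sqrt \<delta> \<le> 2 * S x * sqrt (S x)"
    using S_lower[OF assms] \<delta> by (intro mult_mono) auto
  then have "1 / (2 * S x * sqrt (S x)) \<le> 1 / (2 * \<delta> * sqrt \<delta>)"
    using \<delta> by (intro divide_left_mono) (auto intro!: mult_pos_pos intro: less_le_trans[OF _ S_lower[OF assms]])
  moreover have "0 \<le> 1 / (2 * S x * sqrt (S x))" using S_lower[OF assms] \<delta> by auto
  ultimately have "\<bar>r' x\<bar> \<le> 1 / (2 * \<delta> * sqrt \<delta>) * (B * v x)"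
    unfolding r'_def abs_mult abs_minus_cancel
    using S'_bound[OF assms] \<delta> by (intro mult_mono) (auto simp del: abs_mult)
  then show ?thesis by simp
qed

lemma k_eq: assumes "x1 \<le> x" shows "k x = sqrt ((lam - q x) / p x)"
  using tail_q[OF assms] tail_p[OF assms] lam p0 by (simp add: k_def pos_part_nonneg_id)

text \<open>These two relations make the leading terms cancel in the derivative of the
  amplitudes.\<close>

lemma k_identities: assumes "x1 \<le> x" shows "r x * k x = 1 / p x" "(lam - q x) * r x = k x"
proof -
  have *: "0 < lam - q x" "0 < p x" using tail_q[OF assms] tail_p[OF assms] lam p0 by auto
  define a b where "a = sqrt (lam - q x)" and "b = sqrt (p x)"
  have ab: "0 < a" "0 < b" "lam - q x = a * a" "p x = b * b" using * by (auto simp: a_def b_def)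
  have rk: "r x = 1 / (b * a)" "k x = a / b"
    by (simp_all add: r_def S_def k_eq[OF assms] real_sqrt_mult real_sqrt_divide a_def b_def)
  show "r x * k x = 1 / p x" "(lam - q x) * r x = k x"
    unfolding rk ab(3,4) using ab(1,2) by (simp_all add: field_simps)
qed

text \<open>The energy \<open>N\<close> has derivative \<open>(cmod (f x))\<^sup>2 * S' x\<close>:
  the terms with \<open>g\<close> cancel. Since \<open>S \<ge> \<delta>\<close>, this is at most
  \<open>N / \<delta> * B * v\<close>.\<close>

lemma solution_bounded:
  assumes "sl_solution p q (complex_of_real lam) f g"
  obtains M where "0 \<le> M" "\<And>x. x1 \<le> x \<Longrightarrow> cmod (f x) \<le> M" "\<And>x. x1 \<le> x \<Longrightarrow> cmod (g x) \<le> M"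
proof -
  define N where "N = (\<lambda>x. (cmod (f x))\<^sup>2 * S x + (cmod (g x))\<^sup>2)"
  have f: "ac_from x1 f (\<lambda>t. g t / complex_of_real (p t))"
    and g: "ac_from x1 g (\<lambda>t. (complex_of_real (q t) - complex_of_real lam) * f t)"
    using assms ac_from_mono x1_nonneg unfolding sl_solution_def by blast+
  \<comment> \<open>Squared moduli are written as products with conjugates, so that the complex
    product rule applies; the real part is taken afterwards.\<close>
  note prod = ac_from_add[OF ac_from_mult[OF ac_from_mult[OF f ac_from_cnj[OF f]] ac_from_of_real[OF S_ac]]
      ac_from_mult[OF g ac_from_cnj[OF g]]]
  have N: "ac_from x1 (\<lambda>x. complex_of_real (N x)) (\<lambda>x. complex_of_real ((cmod (f x))\<^sup>2 * S' x))"
  proof (rule ac_from_cong[OF prod])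
    fix x assume x: "x1 \<le> x"
    have p: "p x \<noteq> 0" using tail_p[OF x] p0 by auto
    show "f x * cnj (f x) * complex_of_real (S x) + g x * cnj (g x) = complex_of_real (N x)"
      by (simp add: N_def complex_norm_square del: of_real_power)
    show "(g x / complex_of_real (p x) * cnj (f x) + f x * cnj (g x / complex_of_real (p x))) * complex_of_real (S x) +
         f x * cnj (f x) * complex_of_real (S' x) +
         ((complex_of_real (q x) - complex_of_real lam) * f x * cnj (g x) +
          g x * cnj ((complex_of_real (q x) - complex_of_real lam) * f x)) =
         complex_of_real ((cmod (f x))\<^sup>2 * S' x)"
      using p by (simp add: S_def complex_norm_square field_simps del: of_real_power)
  qed
  have Nac: "ac_from x1 N (\<lambda>x. (cmod (f x))\<^sup>2 * S' x)"
    using ac_from_bounded_linear[OF bounded_linear_Re N] by simp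
  have N0: "0 \<le> N x" if "x1 \<le> x" for x using S_lower[OF that] \<delta> by (simp add: N_def)
  have f_le: "(cmod (f x))\<^sup>2 \<le> N x / \<delta>" if "x1 \<le> x" for x
  proof -
    have "(cmod (f x))\<^sup>2 * \<delta> \<le> (cmod (f x))\<^sup>2 * S x" using S_lower[OF that] by (intro mult_left_mono) auto
    also have "\<dots> \<le> N x" by (simp add: N_def)
    finally show ?thesis using \<delta> by (simp add: field_simps)
  qed
  have N_le: "N X \<le> 2 * N x1" if X: "x1 \<le> X" for X
  proof -
    have "continuous_on {x1..X} N"
      using ac_from_continuous[OF Nac] by (rule continuous_on_subset) auto
    \<comment> \<open>A substitute for Gronwall's inequality: at a maximum point \<open>s\<close>
      the increase \<open>N s - N x1\<close> is at most \<open>N s / \<delta> * B * eps x1\<close>,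
      hence at most \<open>N s / 2\<close>, and is absorbed on the left.\<close>
    then obtain s where s: "s \<in> {x1..X}" "\<And>x. x \<in> {x1..X} \<Longrightarrow> N x \<le> N s"
      using continuous_attains_sup[of "{x1..X}" N] X by auto
    have vs: "set_integrable lborel {x1..s} v"
      using v_int1[OF order_refl] by (rule set_integrable_subset) auto
    have "N s - N x1 = (LINT x:{x1..s}|lborel. (cmod (f x))\<^sup>2 * S' x)"
      using s by (intro ac_from_diff[OF Nac]) auto
    also have "\<dots> \<le> norm \<dots>" by simp
    also have "\<dots> \<le> (LINT x:{x1..s}|lborel. N s / \<delta> * B * v x)"
    proof (rule norm_set_integral_le)
      show "set_integrable lborel {x1..s} (\<lambda>x. (cmod (f x))\<^sup>2 * S' x)"
        by (rule ac_from_integrable[OF Nac order_refl])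
      show "set_integrable lborel {x1..s} (\<lambda>x. N s / \<delta> * B * v x)"
        by (rule set_integrable_mult_right) (rule vs)
      fix x assume x: "x \<in> {x1..s}"
      have "norm ((cmod (f x))\<^sup>2 * S' x) = (cmod (f x))\<^sup>2 * \<bar>S' x\<bar>" by (simp add: abs_mult)
      also have "\<dots> \<le> (N s / \<delta>) * (B * v x)"
      proof (intro mult_mono)
        have "N x / \<delta> \<le> N s / \<delta>" using s x \<delta> by (intro divide_right_mono) auto
        then show "(cmod (f x))\<^sup>2 \<le> N s / \<delta>" using f_le[of x] x by simp
        show "\<bar>S' x\<bar> \<le> B * v x" using x by (intro S'_bound) auto
        show "0 \<le> N s / \<delta>" using N0[of s] s \<delta> by simp
      qed auto
      finally show "norm ((cmod (f x))\<^sup>2 * S' x) \<le> N s / \<delta> * B * v x" by (simp add: mult_ac)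
    qed
    also have "\<dots> = N s / \<delta> * B * (LINT x:{x1..s}|lborel. v x)" by (rule set_integral_mult_right)
    also have "\<dots> \<le> N s / \<delta> * B * eps x1"
    proof (intro mult_left_mono)
      have "eps x1 = (LINT x:{x1..s}|lborel. v x) + eps s"
        using LINT_Ici_split[OF v_int1[OF order_refl], of s] s by (simp add: eps_eq)
      then show "(LINT x:{x1..s}|lborel. v x) \<le> eps x1" using eps_nonneg[of s] by simp
      show "0 \<le> N s / \<delta> * B" using N0[of s] s \<delta> B by simp
    qed
    also have "\<dots> = N s / \<delta> * (B * eps x1)" by simp
    also have "\<dots> \<le> N s / \<delta> * (\<delta> / 2)"
      using tail_eps N0[of s] s \<delta> by (intro mult_left_mono) (auto simp: B_def \<delta>_def)
    also have "\<dots> = N s / 2" using \<delta> by simp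
    finally have "N s \<le> 2 * N x1" by simp
    then show ?thesis using s(2)[of X] X by simp
  qed
  \<comment> \<open>The first entry bounds \<open>f\<close> by way of
    \<open>S \<ge> \<delta>\<close>, the second bounds \<open>g\<close>.\<close>
  define M where "M = max (sqrt (2 * N x1 / \<delta>)) (sqrt (2 * N x1))"
  show ?thesis
  proof (rule that[of M])
    show "0 \<le> M" using N0[of x1] \<delta> by (simp add: M_def le_max_iff_disj)
    fix x assume x: "x1 \<le> x"
    have "(cmod (f x))\<^sup>2 \<le> 2 * N x1 / \<delta>"
      using f_le[OF x] divide_right_mono[OF N_le[OF x], of \<delta>] \<delta> by simp
    then have "cmod (f x) \<le> sqrt (2 * N x1 / \<delta>)" by (rule real_le_rsqrt)
    then show "cmod (f x) \<le> M" by (simp add: M_def)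
    have "(cmod (g x))\<^sup>2 \<le> N x" using S_lower[OF x] \<delta> by (simp add: N_def)
    then have "(cmod (g x))\<^sup>2 \<le> 2 * N x1" using N_le[OF x] by simp
    then have "cmod (g x) \<le> sqrt (2 * N x1)" by (rule real_le_rsqrt)
    then show "cmod (g x) \<le> M" by (simp add: M_def)
  qed
qed

text \<open>\<open>c\<close> projects the pair \<open>(f, g * r)\<close> onto one wave: it is 1 if
  \<open>f = cis (sg * Phi)\<close> and \<open>g * r = \<i> * sg * f\<close>, and 0 for the wave of
  opposite sign.\<close>

lemma amplitude_limit:
  assumes sol: "sl_solution p q (complex_of_real lam) f g" and sg: "sg = 1 \<or> sg = (-1::real)"
  defines "c \<equiv> \<lambda>x. (f x - \<i> * sg * (g x * r x)) * cis (- (sg * Phi x)) / 2"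
  shows "\<exists>L C. \<forall>x\<ge>x1. cmod (c x - L) \<le> C * eps x"
proof -
  have f: "ac_from x1 f (\<lambda>t. g t / complex_of_real (p t))"
    and g: "ac_from x1 g (\<lambda>t. (complex_of_real (q t) - complex_of_real lam) * f t)"
    using sol ac_from_mono x1_nonneg unfolding sl_solution_def by blast+
  obtain M where M: "0 \<le> M" "\<And>x. x1 \<le> x \<Longrightarrow> cmod (g x) \<le> M"
    using solution_bounded[OF sol] by metis
  have Th: "ac_from x1 (\<lambda>x. - (sg * Phi x)) (\<lambda>x. - (sg * k x))"
    using ac_from_minus[OF ac_from_cmult[OF ac_from_mono[OF Phi_ac x1_nonneg]]] by (simp add: k_def[abs_def])
  note prod = ac_from_cmult[OF ac_from_mult[OF ac_from_sub[OF f ac_from_cmult[OF ac_from_mult[OF g ac_from_of_real[OF r_ac]], of "\<i> * sg"]]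
     ac_from_cis[OF Th]], of "1/2"]
  define d where "d = (\<lambda>x. - \<i> * sg * g x * r' x * cis (- (sg * Phi x)) / 2)"
  have c: "ac_from x1 c d"
  proof (rule ac_from_cong[OF prod])
    fix x assume x: "x1 \<le> x"
    show "1 / 2 * ((f x - \<i> * complex_of_real sg * (g x * complex_of_real (r x))) * cis (- (sg * Phi x))) = c x"
      by (simp add: c_def)
    have 1: "complex_of_real (r x) * complex_of_real (k x) = 1 / complex_of_real (p x)"
      using k_identities(1)[OF x] by (metis of_real_1 of_real_divide of_real_mult)
    have 2: "(complex_of_real lam - complex_of_real (q x)) * complex_of_real (r x) = complex_of_real (k x)"
      using k_identities(2)[OF x] by (metis of_real_diff of_real_mult)
    have 3: "complex_of_real sg * complex_of_real sg = 1" using sg by auto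
    \<comment> \<open>The terms with \<open>f\<close> cancel by relation 2, and those with
      \<open>g\<close> by relations 1 and 3; only the one with \<open>r'\<close> survives.\<close>
    have "g x / complex_of_real (p x) - \<i> * complex_of_real sg *
             ((complex_of_real (q x) - complex_of_real lam) * f x * complex_of_real (r x) + g x * complex_of_real (r' x))
           + (f x - \<i> * complex_of_real sg * (g x * complex_of_real (r x))) * (\<i> * complex_of_real (- (sg * k x)))
        = g x * (1 / complex_of_real (p x))
          + \<i> * complex_of_real sg * f x * ((complex_of_real lam - complex_of_real (q x)) * complex_of_real (r x))
          - \<i> * complex_of_real sg * g x * complex_of_real (r' x) - \<i> * complex_of_real sg * f x * complex_of_real (k x)
          - g x * (complex_of_real sg * complex_of_real sg) * (complex_of_real (r x) * complex_of_real (k x))"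
      by (simp add: algebra_simps)
    also have "\<dots> = - \<i> * complex_of_real sg * g x * complex_of_real (r' x)"
      unfolding 1 2 3 by simp
    finally have *: "g x / complex_of_real (p x) - \<i> * complex_of_real sg *
             ((complex_of_real (q x) - complex_of_real lam) * f x * complex_of_real (r x) + g x * complex_of_real (r' x))
           + (f x - \<i> * complex_of_real sg * (g x * complex_of_real (r x))) * (\<i> * complex_of_real (- (sg * k x)))
        = - \<i> * complex_of_real sg * g x * complex_of_real (r' x)" .
    have "1 / 2 *
         ((g x / complex_of_real (p x) - \<i> * complex_of_real sg *
             ((complex_of_real (q x) - complex_of_real lam) * f x * complex_of_real (r x) + g x * complex_of_real (r' x))) *
          cis (- (sg * Phi x)) +
          (f x - \<i> * complex_of_real sg * (g x * complex_of_real (r x))) *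
          (\<i> * complex_of_real (- (sg * k x)) * cis (- (sg * Phi x))))
       = 1 / 2 * ((g x / complex_of_real (p x) - \<i> * complex_of_real sg *
             ((complex_of_real (q x) - complex_of_real lam) * f x * complex_of_real (r x) + g x * complex_of_real (r' x))
           + (f x - \<i> * complex_of_real sg * (g x * complex_of_real (r x))) * (\<i> * complex_of_real (- (sg * k x))))
           * cis (- (sg * Phi x)))"
      by (simp only: distrib_right mult.assoc)
    also have "\<dots> = d x" unfolding * by (simp add: d_def)
    finally show "1 / 2 *
         ((g x / complex_of_real (p x) - \<i> * complex_of_real sg *
             ((complex_of_real (q x) - complex_of_real lam) * f x * complex_of_real (r x) + g x * complex_of_real (r' x))) *
          cis (- (sg * Phi x)) +
          (f x - \<i> * complex_of_real sg * (g x * complex_of_real (r x))) *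
          (\<i> * complex_of_real (- (sg * k x)) * cis (- (sg * Phi x)))) = d x" .
  qed
  define C where "C = M * (B / (2 * \<delta> * sqrt \<delta>))"
  have d: "norm (d x) \<le> C * v x" if "x1 \<le> x" for x
  proof -
    have "norm (d x) = cmod (g x) * \<bar>r' x\<bar> / 2" using sg by (auto simp: d_def norm_mult)
    also have "\<dots> \<le> cmod (g x) * \<bar>r' x\<bar>" by simp
    also have "\<dots> \<le> M * (B / (2 * \<delta> * sqrt \<delta>) * v x)"
      using M r'_bound[OF that] that by (intro mult_mono) auto
    finally show ?thesis by (simp add: C_def)
  qed
  have di: "set_integrable lborel {x1..} d"
    by (rule set_integrable_Ici_dominated[OF ac_from_integrable[OF c order_refl] set_integrable_mult_right d])
      (use v_int1 in auto)
  obtain L where L: "\<And>x. x1 \<le> x \<Longrightarrow> L - c x = (LINT t:{x..}|lborel. d t)"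
    using ac_from_limit[OF c di] by blast
  have "cmod (c x - L) \<le> C * eps x" if x: "x1 \<le> x" for x
  proof -
    have "cmod (LINT t:{x..}|lborel. d t) \<le> C * eps x"
      using x x1 by (intro integral_tail_le_eps set_integrable_subset[OF di] d) auto
    then show ?thesis using L[OF x] by (simp add: norm_minus_commute)
  qed
  then show ?thesis by blast
qed

text \<open>Sum and difference of the two waves give back \<open>f\<close> and \<open>g * r\<close>
  exactly, so replacing the amplitudes by their limits adds only the two O(eps) errors.\<close>

lemma asym_exists:
  assumes sol: "sl_solution p q (complex_of_real lam) f g"
  shows "\<exists>cp cm. asym f g cp cm"
proof -
  define c where "c = (\<lambda>(sg::real) x. (f x - \<i> * sg * (g x * r x)) * cis (- (sg * Phi x)) / 2)"
  obtain cp C1 where 1: "\<And>x. x1 \<le> x \<Longrightarrow> cmod (c 1 x - cp) \<le> C1 * eps x"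
    using amplitude_limit[OF sol, of 1] unfolding c_def by auto
  obtain cm C2 where 2: "\<And>x. x1 \<le> x \<Longrightarrow> cmod (c (-1) x - cm) \<le> C2 * eps x"
    using amplitude_limit[OF sol, of "-1"] unfolding c_def by auto
  have cc: "cis t * cis (- t) = 1" "cis (-t) * cis t = 1" for t by (simp_all add: cis_mult)
  have "cmod (f x - (cp * cis (Phi x) + cm * cis (- Phi x))) \<le> (C1 + C2) * eps x \<and>
     cmod (g x / complex_of_real (sqrt (p x * (lam - q x))) - \<i> * (cp * cis (Phi x) - cm * cis (- Phi x))) \<le> (C1 + C2) * eps x"
    if x: "x1 \<le> x" for x
  proof
    have e1: "c 1 x * cis (Phi x) = (f x - \<i> * (g x * r x)) / 2"
      and e2: "c (-1) x * cis (- Phi x) = (f x + \<i> * (g x * r x)) / 2"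
      by (simp_all add: c_def mult.assoc cc)
    have f: "f x = c 1 x * cis (Phi x) + c (-1) x * cis (- Phi x)" unfolding e1 e2 by (simp add: field_simps)
    have "g x * r x = \<i> * (c 1 x * cis (Phi x) - c (-1) x * cis (- Phi x))"
      unfolding e1 e2 by (simp add: field_simps)
    then have g: "g x / complex_of_real (sqrt (p x * (lam - q x))) = \<i> * (c 1 x * cis (Phi x) - c (-1) x * cis (- Phi x))"
      by (simp add: r_def S_def)
    have n: "cmod ((c 1 x - cp) * cis (Phi x)) + cmod ((c (-1) x - cm) * cis (- Phi x)) \<le> (C1 + C2) * eps x"
      using 1[OF x] 2[OF x] by (simp add: norm_mult distrib_right)
    have "f x - (cp * cis (Phi x) + cm * cis (- Phi x)) = (c 1 x - cp) * cis (Phi x) + (c (-1) x - cm) * cis (- Phi x)"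
      unfolding f by (simp add: algebra_simps)
    then show "cmod (f x - (cp * cis (Phi x) + cm * cis (- Phi x))) \<le> (C1 + C2) * eps x"
      using n norm_triangle_ineq order_trans by metis
    have "g x / complex_of_real (sqrt (p x * (lam - q x))) - \<i> * (cp * cis (Phi x) - cm * cis (- Phi x))
       = \<i> * ((c 1 x - cp) * cis (Phi x) - (c (-1) x - cm) * cis (- Phi x))"
      unfolding g by (simp add: algebra_simps)
    then have "cmod (g x / complex_of_real (sqrt (p x * (lam - q x))) - \<i> * (cp * cis (Phi x) - cm * cis (- Phi x)))
       = cmod ((c 1 x - cp) * cis (Phi x) - (c (-1) x - cm) * cis (- Phi x))" by (simp add: norm_mult)
    then show "cmod (g x / complex_of_real (sqrt (p x * (lam - q x))) - \<i> * (cp * cis (Phi x) - cm * cis (- Phi x))) \<le> (C1 + C2) * eps x"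
      using n norm_triangle_ineq4 order_trans by metis
  qed
  then show ?thesis unfolding asym_def by (blast intro: eventually_at_top_linorderI[of x1])
qed

end

section \<open>Wronskians, Jost solutions and the regular solution\<close>

context jost_tail
begin

text \<open>Beyond \<open>x1\<close> one has \<open>q < lam\<close>, so the integrand in the
  exponent of \<open>K_fun\<close> vanishes there.\<close>

lemma K_eq: assumes "x1 \<le> x"
  shows "(LINT y:{0..x}|lborel. sqrt (pos_part ((q y - lam) / p y))) = (LINT y:{0..}|lborel. sqrt (pos_part ((q y - lam) / p y)))"
proof -
  have "pos_part ((q y - lam) / p y) = 0" if "x < y" for y
    using tail_q[of y] tail_p[of y] that assms lam p0
    by (intro pos_part_nonpos) (auto intro!: divide_nonpos_pos)
  then have "(\<lambda>y. indicator {0..x} y *\<^sub>R sqrt (pos_part ((q y - lam) / p y)))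
      = (\<lambda>y. indicator {0..} y *\<^sub>R sqrt (pos_part ((q y - lam) / p y)))"
    by (auto simp: indicator_def fun_eq_iff not_le)
  then show ?thesis unfolding set_lebesgue_integral_def by (simp only:)
qed

text \<open>An equality, not just an asymptotic relation, because the real part of omega vanishes
  beyond \<open>x1\<close>. It lets the Jost normalisation be read as a condition on
  amplitudes.\<close>

lemma jost_a_eq: assumes "x1 \<le> x"
  shows "jost_a p q sg lam x = complex_of_real (K_fun p q lam) * cis (sg * Phi x)"
proof -
  have x: "0 \<le> x" using assms x1_nonneg by simp
  define I where "I = (LINT y:{0..x}|lborel. sqrt (pos_part ((q y - lam) / p y)))"
  have i1: "set_integrable lborel {0..x} (\<lambda>y. sqrt (pos_part ((q y - lam) / p y)))"
    using sqrt_pos_part_integrable[OF x, of "-1"] by simp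
  have i2: "set_integrable lborel {0..x} (\<lambda>y. sg * sqrt (pos_part ((lam - q y) / p y)))"
    using sqrt_pos_part_integrable[OF x, of 1] by simp
  have "(LINT y:{0..x}|lborel. omega_bv p q sg lam y)
     = (LINT y:{0..x}|lborel. complex_of_real (sqrt (pos_part ((q y - lam) / p y))))
       - (LINT y:{0..x}|lborel. \<i> * complex_of_real (sg * sqrt (pos_part ((lam - q y) / p y))))"
    unfolding omega_bv_def by (intro set_integral_diff(2) set_integrable_of_real i1 set_integrable_mult_right i2)
  also have "\<dots> = complex_of_real I - \<i> * complex_of_real (sg * Phi x)"
    unfolding set_integral_mult_right set_integral_complex_of_real by (simp add: I_def Phi_fun_def)
  finally have "jost_a p q sg lam x = exp (complex_of_real (- I)) * exp (\<i> * complex_of_real (sg * Phi x))"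
    by (simp add: jost_a_def exp_add[symmetric])
  then show ?thesis
    using K_eq[OF assms] by (simp add: cis_conv_exp K_fun_def I_def exp_of_real[symmetric])
qed

text \<open>The slope comes from \<open>lam - q \<ge> lam / 2\<close> and
  \<open>p \<le> 2 * p0\<close>.\<close>

lemma Phi_growth: assumes "x1 \<le> x" "x \<le> y"
  shows "sqrt (lam / (4 * p0)) * (y - x) \<le> Phi y - Phi x"
proof -
  have ac: "ac_from x1 Phi k"
    using ac_from_mono[OF Phi_ac x1_nonneg] by (simp add: k_def[abs_def])
  have "sqrt (lam / (4 * p0)) * (y - x) = (LINT t:{x..y}|lborel. sqrt (lam / (4 * p0)))"
    using assms by (simp add: set_lebesgue_integral_def)
  also have "\<dots> \<le> (LINT t:{x..y}|lborel. k t)"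
  proof (rule set_integral_mono)
    show "set_integrable lborel {x..y} k" by (rule ac_from_integrable[OF ac assms(1)])
    show "set_integrable lborel {x..y} (\<lambda>t. sqrt (lam / (4 * p0)))"
      by (rule borel_integrable_atLeastAtMost') auto
    fix t assume "t \<in> {x..y}"
    then have t: "x1 \<le> t" using assms by simp
    have "lam / (4 * p0) = (lam / 2) / (2 * p0)" by simp
    also have "\<dots> \<le> (lam - q t) / p t"
      using tail_q[OF t] tail_p[OF t] lam p0 by (intro frac_le) auto
    finally show "sqrt (lam / (4 * p0)) \<le> k t" using k_eq[OF t] by simp
  qed
  also have "\<dots> = Phi y - Phi x" using ac_from_diff[OF ac assms] by simp
  finally show ?thesis .
qed

text \<open>The phase is continuous and unbounded, so it meets every residue modulo 2 pi arbitrarily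
  far out. A limit at infinity can thus be evaluated at a prescribed phase.\<close>

lemma Phi_attains:
  obtains x :: real and n :: int where "X \<le> x" "Phi x = 2 * pi * of_int n + t"
proof -
  define a where "a = max X x1"
  define c where "c = sqrt (lam / (4 * p0))"
  have c: "0 < c" using lam p0 by (simp add: c_def)
  define n :: int where "n = \<lceil>(Phi a - t) / (2 * pi)\<rceil>"
  define y where "y = 2 * pi * of_int n + t"
  have "(Phi a - t) / (2 * pi) \<le> of_int n" unfolding n_def by (rule le_of_int_ceiling)
  then have y: "Phi a \<le> y" by (simp add: y_def field_simps)
  \<comment> \<open>The point where the linear lower bound for \<open>Phi\<close> reaches
    \<open>y\<close>.\<close>
  define b where "b = a + (y - Phi a) / c"
  have ab: "a \<le> b" using y c by (simp add: b_def)
  have "c * (b - a) \<le> Phi b - Phi a" using Phi_growth[of a b] ab by (simp add: a_def c_def)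
  then have "y \<le> Phi b" using c by (simp add: b_def)
  moreover have "continuous_on {a..b} Phi"
    using ac_from_continuous[OF Phi_ac] by (rule continuous_on_subset) (use x1_nonneg in \<open>auto simp: a_def\<close>)
  ultimately obtain x where "a \<le> x" "Phi x = y" using IVT'[of Phi a y b] y ab by auto
  then show ?thesis using that[of x n] by (simp add: a_def y_def)
qed

end

section \<open>Amplitude pairs and the solutions they determine\<close>

context jost_setting
begin

lemma tail_exists: obtains x1 where "jost_tail p p' q q' p0 x0 lam x1"
proof -
  have "((\<lambda>x. (2 * lam + 2 * p0) * eps x) \<longlongrightarrow> (2 * lam + 2 * p0) * 0) at_top"
    by (intro tendsto_intros eps_tendsto_0)
  then have 1: "\<forall>\<^sub>F x in at_top. (2 * lam + 2 * p0) * eps x < p0 * lam / 8"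
    using lam p0 by (intro order_tendstoD(2)) auto
  have 2: "\<forall>\<^sub>F x in at_top. q x < lam / 2" "\<forall>\<^sub>F x in at_top. - lam < q x"
    by (rule order_tendstoD[OF q_lim]; use lam in simp)+
  have 3: "\<forall>\<^sub>F x in at_top. p x < 2 * p0" "\<forall>\<^sub>F x in at_top. p0 / 2 < p x"
    by (rule order_tendstoD[OF p_lim]; use p0 in simp)+
  have "\<forall>\<^sub>F x in at_top. (2 * lam + 2 * p0) * eps x < p0 * lam / 8 \<and> q x < lam / 2 \<and> - lam < q x \<and>
      p x < 2 * p0 \<and> p0 / 2 < p x"
    using 1 2 3 by eventually_elim auto
  then obtain X where X: "\<And>x. X \<le> x \<Longrightarrow> (2 * lam + 2 * p0) * eps x < p0 * lam / 8 \<and> q x < lam / 2 \<and> - lam < q x \<and>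
      p x < 2 * p0 \<and> p0 / 2 < p x" unfolding eventually_at_top_linorder by blast
  have "jost_tail p p' q q' p0 x0 lam (max X x0)"
  proof
    fix x assume "max X x0 \<le> x"
    then have "X \<le> x" by simp
    note X[OF this]
    then show "lam / 2 \<le> lam - q x \<and> lam - q x \<le> 2 * lam" "p0 / 2 \<le> p x \<and> p x \<le> 2 * p0" by auto
  qed (use X[of "max X x0"] in auto)
  then show ?thesis by (rule that)
qed

lemma asym_exists:
  assumes "sl_solution p q (complex_of_real lam) f g"
  shows "\<exists>cp cm. asym f g cp cm"
proof -
  obtain x1 where "jost_tail p p' q q' p0 x0 lam x1" by (rule tail_exists)
  then interpret jost_tail p p' q q' p0 x0 lam x1 .
  show ?thesis by (rule asym_exists[OF assms])
qed

lemma asym_lincomb: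
  assumes "asym f1 g1 a1 b1" "asym f2 g2 a2 b2"
  shows "asym (\<lambda>x. \<alpha> * f1 x + \<beta> * f2 x) (\<lambda>x. \<alpha> * g1 x + \<beta> * g2 x) (\<alpha> * a1 + \<beta> * a2) (\<alpha> * b1 + \<beta> * b2)"
proof -
  obtain C1 where C1: "\<forall>\<^sub>F x in at_top.
     cmod (f1 x - (a1 * cis (Phi x) + b1 * cis (- Phi x))) \<le> C1 * eps x \<and>
     cmod (g1 x / complex_of_real (sqrt (p x * (lam - q x))) - \<i> * (a1 * cis (Phi x) - b1 * cis (- Phi x))) \<le> C1 * eps x"
    using assms(1) unfolding asym_def by blast
  obtain C2 where C2: "\<forall>\<^sub>F x in at_top.
     cmod (f2 x - (a2 * cis (Phi x) + b2 * cis (- Phi x))) \<le> C2 * eps x \<and>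
     cmod (g2 x / complex_of_real (sqrt (p x * (lam - q x))) - \<i> * (a2 * cis (Phi x) - b2 * cis (- Phi x))) \<le> C2 * eps x"
    using assms(2) unfolding asym_def by blast
  have tri: "cmod (\<alpha> * u + \<beta> * w) \<le> (cmod \<alpha> * C1 + cmod \<beta> * C2) * e"
    if "cmod u \<le> C1 * e" "cmod w \<le> C2 * e" for u w e
  proof -
    have "cmod (\<alpha> * u + \<beta> * w) \<le> cmod \<alpha> * cmod u + cmod \<beta> * cmod w"
      by (metis norm_triangle_ineq norm_mult)
    also have "\<dots> \<le> cmod \<alpha> * (C1 * e) + cmod \<beta> * (C2 * e)"
      using that by (intro add_mono mult_left_mono) auto
    finally show ?thesis by (simp add: algebra_simps)
  qed
  show ?thesis unfolding asym_def
  proof (intro exI)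
    show "\<forall>\<^sub>F x in at_top.
     cmod (\<alpha> * f1 x + \<beta> * f2 x - ((\<alpha> * a1 + \<beta> * a2) * cis (Phi x) + (\<alpha> * b1 + \<beta> * b2) * cis (- Phi x)))
       \<le> (cmod \<alpha> * C1 + cmod \<beta> * C2) * eps x \<and>
     cmod ((\<alpha> * g1 x + \<beta> * g2 x) / complex_of_real (sqrt (p x * (lam - q x)))
       - \<i> * ((\<alpha> * a1 + \<beta> * a2) * cis (Phi x) - (\<alpha> * b1 + \<beta> * b2) * cis (- Phi x)))
       \<le> (cmod \<alpha> * C1 + cmod \<beta> * C2) * eps x"
      using C1 C2
    proof eventually_elim
      case (elim x)
      from tri[OF elim(1)[THEN conjunct1] elim(2)[THEN conjunct1]]
        tri[OF elim(1)[THEN conjunct2] elim(2)[THEN conjunct2]]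
      show ?case by (simp add: algebra_simps add_divide_distrib)
    qed
  qed
qed

text \<open>Conjugation exchanges the two waves, hence the swapped order of the amplitudes.\<close>

lemma asym_cnj:
  assumes "asym f g a b"
  shows "asym (\<lambda>x. cnj (f x)) (\<lambda>x. cnj (g x)) (cnj b) (cnj a)"
proof -
  obtain C where "\<forall>\<^sub>F x in at_top.
     cmod (f x - (a * cis (Phi x) + b * cis (- Phi x))) \<le> C * eps x \<and>
     cmod (g x / complex_of_real (sqrt (p x * (lam - q x))) - \<i> * (a * cis (Phi x) - b * cis (- Phi x))) \<le> C * eps x"
    using assms unfolding asym_def by blast
  then have "\<forall>\<^sub>F x in at_top.
     cmod (cnj (f x) - (cnj b * cis (Phi x) + cnj a * cis (- Phi x))) \<le> C * eps x \<and>
     cmod (cnj (g x) / complex_of_real (sqrt (p x * (lam - q x))) - \<i> * (cnj b * cis (Phi x) - cnj a * cis (- Phi x))) \<le> C * eps x"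
  proof eventually_elim
    case (elim x)
    have "cnj (f x) - (cnj b * cis (Phi x) + cnj a * cis (- Phi x)) = cnj (f x - (a * cis (Phi x) + b * cis (- Phi x)))"
      by (simp add: cis_cnj)
    moreover have "cnj (g x) / complex_of_real (sqrt (p x * (lam - q x))) - \<i> * (cnj b * cis (Phi x) - cnj a * cis (- Phi x))
       = cnj (g x / complex_of_real (sqrt (p x * (lam - q x))) - \<i> * (a * cis (Phi x) - b * cis (- Phi x)))"
      by (simp add: cis_cnj algebra_simps)
    ultimately show ?case using elim by (simp only: complex_mod_cnj)
  qed
  then show ?thesis unfolding asym_def by blast
qed

lemma tendsto_0_of_eps:
  fixes h :: "real \<Rightarrow> complex"
  assumes "\<forall>\<^sub>F x in at_top. cmod (h x) \<le> C * eps x"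
  shows "(h \<longlongrightarrow> 0) at_top"
proof (rule Lim_null_comparison[OF assms])
  show "((\<lambda>x. C * eps x) \<longlongrightarrow> 0) at_top" using tendsto_mult_right_zero[OF eps_tendsto_0] .
qed

lemma asymD:
  assumes "asym f g a b"
  shows "((\<lambda>x. f x - (a * cis (Phi x) + b * cis (- Phi x))) \<longlongrightarrow> 0) at_top"
    "((\<lambda>x. g x / complex_of_real (sqrt (p x * (lam - q x))) - \<i> * (a * cis (Phi x) - b * cis (- Phi x))) \<longlongrightarrow> 0) at_top"
proof -
  obtain C where "\<forall>\<^sub>F x in at_top.
     cmod (f x - (a * cis (Phi x) + b * cis (- Phi x))) \<le> C * eps x \<and>
     cmod (g x / complex_of_real (sqrt (p x * (lam - q x))) - \<i> * (a * cis (Phi x) - b * cis (- Phi x))) \<le> C * eps x"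
    using assms unfolding asym_def by blast
  then show "((\<lambda>x. f x - (a * cis (Phi x) + b * cis (- Phi x))) \<longlongrightarrow> 0) at_top"
    "((\<lambda>x. g x / complex_of_real (sqrt (p x * (lam - q x))) - \<i> * (a * cis (Phi x) - b * cis (- Phi x))) \<longlongrightarrow> 0) at_top"
    unfolding eventually_conj_iff by (blast intro: tendsto_0_of_eps)+
qed

text \<open>The oscillating comparison functions \<open>P\<close> and \<open>Q\<close> need not
  converge, so the limit laws for products do not apply to \<open>a\<close> and \<open>b\<close>
  themselves; boundedness of \<open>P\<close> and \<open>Q\<close> is what makes the cross terms
  vanish.\<close>

lemma tendsto_mult_perturb:
  fixes a b P Q :: "real \<Rightarrow> complex"
  assumes "((\<lambda>x. a x - P x) \<longlongrightarrow> 0) at_top" "((\<lambda>x. b x - Q x) \<longlongrightarrow> 0) at_top"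
    "\<And>x. cmod (P x) \<le> M" "\<And>x. cmod (Q x) \<le> M"
  shows "((\<lambda>x. a x * b x - P x * Q x) \<longlongrightarrow> 0) at_top"
proof -
  have 1: "((\<lambda>x. (a x - P x) * Q x) \<longlongrightarrow> 0) at_top"
    by (rule lim_null_mult_right_bounded[OF assms(1)]) (use assms(4) in \<open>auto intro: always_eventually\<close>)
  have 2: "((\<lambda>x. P x * (b x - Q x)) \<longlongrightarrow> 0) at_top"
    by (rule lim_null_mult_left_bounded[OF _ assms(2)]) (use assms(3) in \<open>auto intro: always_eventually\<close>)
  have "((\<lambda>x. (a x - P x) * (b x - Q x) + (a x - P x) * Q x + P x * (b x - Q x)) \<longlongrightarrow> 0 * 0 + 0 + 0) at_top"
    by (intro tendsto_add tendsto_mult assms 1 2)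
  then show ?thesis by (simp add: algebra_simps)
qed

text \<open>The Wronskian is constant, so its value at 0 can be computed at infinity, where
  \<open>f\<close> and \<open>g / s\<close> may be replaced by their leading waves and
  \<open>s\<close> tends to \<open>sqrt (p0 * lam)\<close>.\<close>

lemma asym_wronskian:
  assumes sol: "sl_solution p q (complex_of_real lam) f1 g1" "sl_solution p q (complex_of_real lam) f2 g2"
    and as: "asym f1 g1 a1 b1" "asym f2 g2 a2 b2"
  shows "g1 0 * f2 0 - f1 0 * g2 0 = 2 * \<i> * complex_of_real (sqrt (p0 * lam)) * (a1 * b2 - b1 * a2)"
proof -
  define s where "s x = complex_of_real (sqrt (p x * (lam - q x)))" for x
  define P where "P a b x = a * cis (Phi x) + b * cis (- Phi x)" for a b x
  define Q where "Q a b x = \<i> * (a * cis (Phi x) - b * cis (- Phi x))" for a b x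
  have Pb: "cmod (P a b x) \<le> cmod a + cmod b" for a b x
    unfolding P_def by (rule norm_triangle_le) (simp add: norm_mult)
  have Qb: "cmod (Q a b x) \<le> cmod a + cmod b" for a b x
    unfolding Q_def norm_mult by (simp, rule norm_triangle_le_diff) (simp add: norm_mult)
  define M where "M = cmod a1 + cmod b1 + cmod a2 + cmod b2"
  have M: "cmod (P a1 b1 x) \<le> M" "cmod (Q a1 b1 x) \<le> M" "cmod (P a2 b2 x) \<le> M" "cmod (Q a2 b2 x) \<le> M" for x
    using Pb[of a1 b1 x] Qb[of a1 b1 x] Pb[of a2 b2 x] Qb[of a2 b2 x] norm_ge_zero[of a1] norm_ge_zero[of b1]
      norm_ge_zero[of a2] norm_ge_zero[of b2] unfolding M_def by linarith+
  note D = asymD[OF as(1), folded s_def P_def Q_def] asymD[OF as(2), folded s_def P_def Q_def]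
  have l1: "((\<lambda>x. g1 x / s x * f2 x - Q a1 b1 x * P a2 b2 x) \<longlongrightarrow> 0) at_top"
    by (rule tendsto_mult_perturb[OF D(2,3) M(2,3)])
  have l2: "((\<lambda>x. f1 x * (g2 x / s x) - P a1 b1 x * Q a2 b2 x) \<longlongrightarrow> 0) at_top"
    by (rule tendsto_mult_perturb[OF D(1,4) M(1,4)])
  have c1: "cis t * (cis (- t) * z) = z" for t z by (simp add: mult.assoc[symmetric] cis_mult)
  \<comment> \<open>The products of two waves of equal sign, which still oscillate, cancel; the
    mixed products are constant.\<close>
  have PQ: "Q a1 b1 x * P a2 b2 x - P a1 b1 x * Q a2 b2 x = 2 * \<i> * (a1 * b2 - b1 * a2)" for x
    unfolding P_def Q_def by (simp add: algebra_simps c1 cis_mult)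
  have slim: "(s \<longlongrightarrow> complex_of_real (sqrt (p0 * (lam - 0)))) at_top"
    unfolding s_def by (intro tendsto_intros p_lim q_lim)
  \<comment> \<open>By \<open>PQ\<close> this function is eventually the constant Wronskian, written
    so that each part has a limit.\<close>
  have "((\<lambda>x. s x * ((g1 x / s x * f2 x - Q a1 b1 x * P a2 b2 x) - (f1 x * (g2 x / s x) - P a1 b1 x * Q a2 b2 x)
       + 2 * \<i> * (a1 * b2 - b1 * a2)))
      \<longlongrightarrow> complex_of_real (sqrt (p0 * (lam - 0))) * (0 - 0 + 2 * \<i> * (a1 * b2 - b1 * a2))) at_top"
    by (intro tendsto_intros slim l1 l2)
  moreover have "\<forall>\<^sub>F x in at_top. s x * ((g1 x / s x * f2 x - Q a1 b1 x * P a2 b2 x) - (f1 x * (g2 x / s x) - P a1 b1 x * Q a2 b2 x)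
       + 2 * \<i> * (a1 * b2 - b1 * a2)) = g1 0 * f2 0 - f1 0 * g2 0"
  proof -
    have "\<forall>\<^sub>F x in at_top. q x < lam" using lam by (intro order_tendstoD[OF q_lim])
    then show ?thesis using eventually_ge_at_top[of 0]
    proof eventually_elim
      case (elim x)
      then have s: "s x \<noteq> 0" using p_pos[of x] by (simp add: s_def)
      have "s x * ((g1 x / s x * f2 x - Q a1 b1 x * P a2 b2 x) - (f1 x * (g2 x / s x) - P a1 b1 x * Q a2 b2 x)
         + 2 * \<i> * (a1 * b2 - b1 * a2)) = s x * (g1 x / s x * f2 x - f1 x * (g2 x / s x))"
        unfolding PQ[of x, symmetric] by simp
      also have "\<dots> = g1 x * f2 x - f1 x * g2 x" using s by (simp add: field_simps)
      also have "\<dots> = g1 0 * f2 0 - f1 0 * g2 0" by (rule wronskian_const[OF sol elim(2)])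
      finally show ?case .
    qed
  qed
  ultimately have "((\<lambda>x::real. g1 0 * f2 0 - f1 0 * g2 0) \<longlongrightarrow> complex_of_real (sqrt (p0 * (lam - 0))) * (0 - 0 + 2 * \<i> * (a1 * b2 - b1 * a2))) at_top"
    by (rule Lim_transform_eventually)
  from tendsto_unique[OF trivial_limit_at_top_linorder tendsto_const this] show ?thesis
    by (simp add: mult_ac)
qed

text \<open>At points with phase \<open>t\<close> modulo 2 pi the leading part always has the value
  \<open>a * cis t + b * cis (- t)\<close>, which must therefore be zero; \<open>t = 0\<close> and
  \<open>t = pi / 2\<close> give two independent equations. Information on \<open>f\<close> alone
  suffices here, which is all that the definition of \<open>jost_bv\<close> offers.\<close>

lemma asym_tendsto_0:
  assumes "asym f g a b" "(f \<longlongrightarrow> 0) at_top"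
  shows "a = 0 \<and> b = 0"
proof -
  obtain x1 where "jost_tail p p' q q' p0 x0 lam x1" by (rule tail_exists)
  then interpret jost_tail p p' q q' p0 x0 lam x1 .
  have "((\<lambda>x. f x - (f x - (a * cis (Phi x) + b * cis (- Phi x)))) \<longlongrightarrow> 0 - 0) at_top"
    by (intro tendsto_diff assms(2) asymD[OF assms(1)])
  then have *: "((\<lambda>x. a * cis (Phi x) + b * cis (- Phi x)) \<longlongrightarrow> 0) at_top" by simp
  have small: "cmod (a * cis t + b * cis (- t)) \<le> 0" for t
  proof (rule field_le_epsilon)
    fix e :: real assume "e > 0"
    then have "\<forall>\<^sub>F x in at_top. cmod (a * cis (Phi x) + b * cis (- Phi x)) < e"
      using tendstoD[OF *] by simp
    then obtain X where X: "\<And>x. X \<le> x \<Longrightarrow> cmod (a * cis (Phi x) + b * cis (- Phi x)) < e"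
      unfolding eventually_at_top_linorder by blast
    obtain x n where x: "X \<le> x" "Phi x = 2 * pi * of_int n + t" by (rule Phi_attains)
    have c1: "cis (Phi x) = cis t" unfolding x(2) cis_mult[symmetric] by simp
    have "cis (- Phi x) = cis (- t)" using c1 by (metis cis_cnj)
    then show "cmod (a * cis t + b * cis (- t)) \<le> 0 + e" using X[OF x(1)] c1 by simp
  qed
  have "a + b = 0" using small[of 0] by simp
  moreover have "a * \<i> - b * \<i> = 0" using small[of "pi/2"] by (simp add: cis_cnj[symmetric])
  then have "a - b = 0" by (simp add: left_diff_distrib[symmetric])
  ultimately show ?thesis by auto
qed

text \<open>Nondegeneracy of the Wronskian: the solutions with initial data (1, 0) and (0, 1)
  extract \<open>g 0\<close> and \<open>- f 0\<close>.\<close>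

lemma sl_solution_eq_0:
  assumes sol: "sl_solution p q (complex_of_real lam) f g"
    and W: "\<And>f2 g2. sl_solution p q (complex_of_real lam) f2 g2 \<Longrightarrow> g 0 * f2 0 - f 0 * g2 0 = 0"
    and "0 \<le> x"
  shows "f x = 0" "g x = 0"
proof -
  obtain f1 g1 where 1: "sl_solution p q (complex_of_real lam) f1 g1" "f1 0 = 1" "g1 0 = 0"
    using sl_solution_exists by blast
  obtain f2 g2 where 2: "sl_solution p q (complex_of_real lam) f2 g2" "f2 0 = 0" "g2 0 = 1"
    using sl_solution_exists by blast
  have z: "f 0 = 0" "g 0 = 0" using W[OF 1(1)] W[OF 2(1)] 1 2 by auto
  have "sl_solution p q (complex_of_real lam) (\<lambda>x. 0) (\<lambda>x. 0)"
    using sl_solution_lincomb[OF 1(1) 1(1), of 0 0] by simp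
  from sl_solution_unique[OF sol this _ _ \<open>0 \<le> x\<close>] z show "f x = 0" "g x = 0" by auto
qed

lemma asym_0_imp_eq_0:
  assumes sol: "sl_solution p q (complex_of_real lam) f g" and as: "asym f g 0 0" and x: "0 \<le> x"
  shows "f x = 0"
proof (rule sl_solution_eq_0(1)[OF sol _ x])
  fix f2 g2 assume s: "sl_solution p q (complex_of_real lam) f2 g2"
  obtain a b where "asym f2 g2 a b" using asym_exists[OF s] by blast
  from asym_wronskian[OF sol s as this] show "g 0 * f2 0 - f 0 * g2 0 = 0" by simp
qed

text \<open>Two solutions with Wronskian -1 have amplitude pairs with nonzero determinant
  \<open>D\<close>; \<alpha> and \<beta> are given by Cramer's rule.\<close>

lemma asym_surj:
  obtains f g where "sl_solution p q (complex_of_real lam) f g" "asym f g a b"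
proof -
  obtain f1 g1 where 1: "sl_solution p q (complex_of_real lam) f1 g1" "f1 0 = 1" "g1 0 = 0"
    using sl_solution_exists by blast
  obtain f2 g2 where 2: "sl_solution p q (complex_of_real lam) f2 g2" "f2 0 = 0" "g2 0 = 1"
    using sl_solution_exists by blast
  obtain a1 b1 where as1: "asym f1 g1 a1 b1" using asym_exists[OF 1(1)] by blast
  obtain a2 b2 where as2: "asym f2 g2 a2 b2" using asym_exists[OF 2(1)] by blast
  define D where "D = a1 * b2 - b1 * a2"
  have D: "D \<noteq> 0" using asym_wronskian[OF 1(1) 2(1) as1 as2] 1 2 by (auto simp: D_def)
  define \<alpha> where "\<alpha> = (a * b2 - b * a2) / D"
  define \<beta> where "\<beta> = (a1 * b - b1 * a) / D"
  have "\<alpha> * a1 + \<beta> * a2 = a * D / D" "\<alpha> * b1 + \<beta> * b2 = b * D / D"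
    by (simp_all add: \<alpha>_def \<beta>_def D_def add_divide_distrib[symmetric] algebra_simps)
  then have "\<alpha> * a1 + \<beta> * a2 = a" "\<alpha> * b1 + \<beta> * b2 = b" using D by simp_all
  then show ?thesis
    using that[OF sl_solution_lincomb[OF 1(1) 2(1), of \<alpha> \<beta>]] asym_lincomb[OF as1 as2, of \<alpha> \<beta>] by simp
qed

lemma K_pos: "0 < K_fun p q lam" by (simp add: K_fun_def)

text \<open>The local predicate \<open>J\<close> is the one inside the definite description.
  Existence comes from \<open>asym_surj\<close>; two functions satisfying \<open>J\<close> differ by
  a solution that tends to zero.\<close>

lemma jost_bv_spec:
  assumes sg: "sg = 1 \<or> sg = (-1::real)"
  obtains g where "sl_solution p q (complex_of_real lam) (jost_bv p p' q q' x0 sg lam) g"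
    "asym (jost_bv p p' q q' x0 sg lam) g
       (if sg = 1 then K_fun p q lam else 0) (if sg = 1 then 0 else K_fun p q lam)"
proof -
  let ?K = "K_fun p q lam"
  define a where "a = complex_of_real (if sg = 1 then ?K else 0)"
  define b where "b = complex_of_real (if sg = 1 then 0 else ?K)"
  define J where "J = (\<lambda>f. ode_solution p q (complex_of_real lam) f \<and>
     (\<exists>C. \<forall>\<^sub>F x in at_top. cmod (f x / jost_a p q sg lam x - 1) \<le> C * eps x) \<and> (\<forall>x<0. f x = 0))"
  obtain x1 where "jost_tail p p' q q' p0 x0 lam x1" by (rule tail_exists)
  then interpret jost_tail p p' q q' p0 x0 lam x1 .
  have ja: "jost_a p q sg lam x = a * cis (Phi x) + b * cis (- Phi x)" "cmod (jost_a p q sg lam x) = ?K"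
    if "x1 \<le> x" for x
    using jost_a_eq[OF that, of sg] sg K_pos by (auto simp: a_def b_def norm_mult)
  obtain f0 g0 where f0: "sl_solution p q (complex_of_real lam) f0 g0" "asym f0 g0 a b" by (rule asym_surj)
  \<comment> \<open>The definition prescribes zero on the negative axis, where the differential
    equation says nothing.\<close>
  define f where "f = (\<lambda>x. if x < 0 then 0 else f0 x)"
  have f: "sl_solution p q (complex_of_real lam) f g0"
    using f0(1) unfolding sl_solution_def f_def by (auto elim: ac_from_cong)
  have fas: "asym f g0 a b"
  proof -
    obtain C where "\<forall>\<^sub>F x in at_top.
     cmod (f0 x - (a * cis (Phi x) + b * cis (- Phi x))) \<le> C * eps x \<and>
     cmod (g0 x / complex_of_real (sqrt (p x * (lam - q x))) - \<i> * (a * cis (Phi x) - b * cis (- Phi x))) \<le> C * eps x"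
      using f0(2) unfolding asym_def by blast
    then have "\<forall>\<^sub>F x in at_top.
     cmod (f x - (a * cis (Phi x) + b * cis (- Phi x))) \<le> C * eps x \<and>
     cmod (g0 x / complex_of_real (sqrt (p x * (lam - q x))) - \<i> * (a * cis (Phi x) - b * cis (- Phi x))) \<le> C * eps x"
      using eventually_ge_at_top[of 0] by eventually_elim (simp add: f_def)
    then show ?thesis unfolding asym_def by blast
  qed
  have Jf: "J f"
    unfolding J_def
  proof (intro conjI)
    show "ode_solution p q (complex_of_real lam) f" using f by (auto simp: ode_solution_iff)
    show "\<forall>x<0. f x = 0" by (simp add: f_def)
    obtain C where C: "\<forall>\<^sub>F x in at_top. cmod (f x - (a * cis (Phi x) + b * cis (- Phi x))) \<le> C * eps x"
      using fas unfolding asym_def eventually_conj_iff by blast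
    have "\<forall>\<^sub>F x in at_top. cmod (f x / jost_a p q sg lam x - 1) \<le> C / ?K * eps x"
      using C eventually_ge_at_top[of x1]
    proof eventually_elim
      case (elim x)
      have nz: "jost_a p q sg lam x \<noteq> 0" using ja(2)[OF elim(2)] K_pos by auto
      have "f x / jost_a p q sg lam x - 1 = (f x - jost_a p q sg lam x) / jost_a p q sg lam x"
        using nz by (simp add: field_simps)
      then have "cmod (f x / jost_a p q sg lam x - 1) = cmod (f x - jost_a p q sg lam x) / ?K"
        by (simp add: norm_divide ja(2)[OF elim(2)])
      also have "\<dots> \<le> C * eps x / ?K"
        using elim(1) ja(1)[OF elim(2)] K_pos by (intro divide_right_mono) auto
      finally show ?case by simp
    qed
    then show "\<exists>C. \<forall>\<^sub>F x in at_top. cmod (f x / jost_a p q sg lam x - 1) \<le> C * eps x" by blast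
  qed
  \<comment> \<open>Multiplying the quotient estimate by \<open>jost_a\<close>, whose modulus beyond
    \<open>x1\<close> is the constant K, turns it into an estimate for the difference.\<close>
  have J_lim: "((\<lambda>x. h x - jost_a p q sg lam x) \<longlongrightarrow> 0) at_top" if Jh: "J h" for h
  proof -
    obtain C where C: "\<forall>\<^sub>F x in at_top. cmod (h x / jost_a p q sg lam x - 1) \<le> C * eps x"
      using Jh unfolding J_def by blast
    have "\<forall>\<^sub>F x in at_top. cmod (h x - jost_a p q sg lam x) \<le> (?K * C) * eps x"
      using C eventually_ge_at_top[of x1]
    proof eventually_elim
      case (elim x)
      have nz: "jost_a p q sg lam x \<noteq> 0" using ja(2)[OF elim(2)] K_pos by auto
      have "h x - jost_a p q sg lam x = jost_a p q sg lam x * (h x / jost_a p q sg lam x - 1)"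
        using nz by (simp add: field_simps)
      then have "cmod (h x - jost_a p q sg lam x) = ?K * cmod (h x / jost_a p q sg lam x - 1)"
        by (metis norm_mult ja(2)[OF elim(2)])
      also have "\<dots> \<le> ?K * (C * eps x)" using elim(1) K_pos by (intro mult_left_mono) auto
      finally show ?case by simp
    qed
    then show ?thesis by (rule tendsto_0_of_eps)
  qed
  have "h = f" if Jh: "J h" for h
  proof
    fix x
    obtain gh where gh: "sl_solution p q (complex_of_real lam) h gh"
      using Jh unfolding J_def ode_solution_iff by blast
    define D where "D = (\<lambda>x. 1 * h x + (-1) * f x)"
    define E where "E = (\<lambda>x. 1 * gh x + (-1) * g0 x)"
    have D: "sl_solution p q (complex_of_real lam) D E"
      unfolding D_def E_def by (rule sl_solution_lincomb[OF gh f])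
    obtain c d where cd: "asym D E c d" using asym_exists[OF D] by blast
    have "(D \<longlongrightarrow> 0) at_top"
      using tendsto_diff[OF J_lim[OF Jh] J_lim[OF Jf]] by (simp add: D_def)
    from asym_tendsto_0[OF cd this] cd have "asym D E 0 0" by simp
    then show "h x = f x"
      using asym_0_imp_eq_0[OF D, of x] Jh Jf unfolding J_def D_def by (cases "x < 0") auto
  qed
  with Jf have "The J = f" by (rule the_equality)
  then have "jost_bv p p' q q' x0 sg lam = f" by (simp only: jost_bv_def J_def)
  then show ?thesis using that[of g0] f fas unfolding a_def b_def by auto
qed

text \<open>For real \<open>lam\<close> the conjugate of one Jost solution is again a solution, with
  the same amplitudes as the other one.\<close>

lemma wronsk_cnj: "wronsk_bv p p' q q' x0 (-1) lam = cnj (wronsk_bv p p' q q' x0 1 lam)"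
proof -
  let ?f = "jost_bv p p' q q' x0 1 lam" and ?h = "jost_bv p p' q q' x0 (-1) lam"
  obtain g where g: "sl_solution p q (complex_of_real lam) ?f g" "asym ?f g (K_fun p q lam) 0"
    using jost_bv_spec[of 1] by auto
  obtain e where e: "sl_solution p q (complex_of_real lam) ?h e" "asym ?h e 0 (K_fun p q lam)"
    using jost_bv_spec[of "-1"] by auto
  have c: "sl_solution p q (complex_of_real lam) (\<lambda>x. cnj (?f x)) (\<lambda>x. cnj (g x))"
    using sl_solution_cnj[OF g(1)] by simp
  have "1 * ?h 0 + (-1) * cnj (?f 0) = 0"
    using asym_0_imp_eq_0[OF sl_solution_lincomb[OF e(1) c, of 1 "-1"], of 0]
      asym_lincomb[OF e(2) asym_cnj[OF g(2)], of 1 "-1"] by simp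
  then show ?thesis by (simp add: wronsk_bv_def)
qed

text \<open>If one Jost solution vanished at 0, so would its conjugate, and then their Wronskian;
  but that equals \<open>2 * \<i> * sqrt (p0 * lam)\<close> times the square of K.\<close>

lemma wronsk_nonzero: "wronsk_bv p p' q q' x0 1 lam \<noteq> 0"
proof
  let ?f = "jost_bv p p' q q' x0 1 lam" and ?h = "jost_bv p p' q q' x0 (-1) lam"
  assume w: "wronsk_bv p p' q q' x0 1 lam = 0"
  then have "?f 0 = 0" "?h 0 = 0"
    using wronsk_cnj p_pos[of 0] by (auto simp: wronsk_bv_def)
  moreover obtain g where g: "sl_solution p q (complex_of_real lam) ?f g" "asym ?f g (K_fun p q lam) 0"
    using jost_bv_spec[of 1] by auto
  moreover obtain e where e: "sl_solution p q (complex_of_real lam) ?h e" "asym ?h e 0 (K_fun p q lam)"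
    using jost_bv_spec[of "-1"] by auto
  ultimately have "sqrt (p0 * lam) * K_fun p q lam = 0"
    using asym_wronskian[OF g(1) e(1) g(2) e(2)] by auto
  then show False using K_pos lam p0 by auto
qed

text \<open>The regular solution is normalised by its derivative at 0, while the system uses the
  quasi-derivative; continuity of \<open>g / p\<close> connects the two.\<close>

lemma sl_solution_deriv_0:
  assumes sol: "sl_solution p q z f g"
  shows "(f has_vector_derivative g 0 / complex_of_real (p 0)) (at 0 within {0..})"
proof -
  let ?d = "\<lambda>t. g t / complex_of_real (p t)"
  have f: "ac_from 0 f ?d" and g: "continuous_on {0..} g"
    using sol ac_from_continuous by (auto simp: sl_solution_def)
  have "continuous_on {0..1} ?d"
    using p_pos by (intro continuous_intros continuous_on_subset[OF g] continuous_on_subset[OF p_cont]) force+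
  then have "((\<lambda>u. integral {0..u} ?d) has_vector_derivative ?d 0) (at 0 within {0..1})"
    by (rule integral_has_vector_derivative) auto
  then have "((\<lambda>u. f 0 + integral {0..u} ?d) has_vector_derivative 0 + ?d 0) (at 0 within {0..1})"
    by (intro has_vector_derivative_add has_vector_derivative_const)
  then have "(f has_vector_derivative 0 + ?d 0) (at 0 within {0..1})"
  proof (rule has_vector_derivative_transform[rotated 2])
    show "f x = f 0 + integral {0..x} ?d" if "x \<in> {0..1}" for x
      using ac_from_D[OF f, of x] that by (metis atLeastAtMost_iff set_borel_integral_eq_integral(2))
  qed auto
  moreover have "at 0 within {0..1} = at (0::real) within {0..}"
    by (rule at_within_nhd[of _ "{..<1}"]) auto
  ultimately show ?thesis by simp
qed

lemma regular_solution_spec: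
  obtains g where "sl_solution p q z (regular_solution p q z) g" "regular_solution p q z 0 = 0"
    "g 0 = complex_of_real (p 0)"
proof -
  define J where "J = (\<lambda>f. ode_solution p q z f \<and> f 0 = 0 \<and>
     (f has_vector_derivative 1) (at 0 within {0..}) \<and> (\<forall>x<0. f x = (0::complex)))"
  have p0': "complex_of_real (p 0) \<noteq> 0" using p_pos[of 0] by simp
  obtain f0 g0 where f0: "sl_solution p q z f0 g0" "f0 0 = 0" "g0 0 = complex_of_real (p 0)"
    using sl_solution_exists by blast
  define f where "f = (\<lambda>x. if x < 0 then 0 else f0 x)"
  have f: "sl_solution p q z f g0"
    using f0(1) unfolding sl_solution_def f_def by (auto elim: ac_from_cong)
  have Jf: "J f"
    using f sl_solution_deriv_0[OF f] f0 p0' by (auto simp: J_def ode_solution_iff f_def)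
  have "h = f" if Jh: "J h" for h
  proof
    fix x
    obtain gh where gh: "sl_solution p q z h gh" using Jh unfolding J_def ode_solution_iff by blast
    \<comment> \<open>The one-sided filter is nontrivial, so the derivative at 0 is unique and fixes
      \<open>gh 0\<close>.\<close>
    have "at (0::real) within {0..} \<noteq> bot"
      using at_within_Ici_at_right[of "0::real"] by simp
    then have "gh 0 / complex_of_real (p 0) = 1"
      using vector_derivative_unique_within[OF _ sl_solution_deriv_0[OF gh]] Jh unfolding J_def by blast
    then have "gh 0 = g0 0" using f0 p0' by (simp add: field_simps)
    moreover have "h 0 = f 0" using Jh Jf by (simp add: J_def)
    ultimately show "h x = f x"
      using sl_solution_unique(1)[OF gh f, of x] Jh Jf unfolding J_def by (cases "x < 0") auto
  qed
  with Jf have "The J = f" by (rule the_equality)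
  then have "regular_solution p q z = f" by (simp only: regular_solution_def J_def)
  then show ?thesis using that[of g0] f f0 by (simp add: f_def)
qed

theorem regular_solution_asymptotics:
  assumes eta: "wronsk_bv p p' q q' x0 1 lam = complex_of_real (kappa_fun p p' q q' x0 lam) * exp (\<i> * complex_of_real \<eta>)"
  shows "\<exists>C. \<forall>\<^sub>F x in at_top.
     cmod (regular_solution p q (complex_of_real lam) x
       - complex_of_real (kappa_fun p p' q q' x0 lam / (sqrt (p0 * lam) * K_fun p q lam) * sin (Phi x - \<eta>)))
     \<le> C * eps x"
proof -
  let ?f = "jost_bv p p' q q' x0 1 lam" and ?h = "jost_bv p p' q q' x0 (-1) lam"
  let ?\<phi> = "regular_solution p q (complex_of_real lam)"
  let ?w = "wronsk_bv p p' q q' x0 1 lam"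
  define \<kappa> K s where "\<kappa> = kappa_fun p p' q q' x0 lam" and "K = K_fun p q lam" and "s = sqrt (p0 * lam)"
  have pos: "K \<noteq> 0" "s \<noteq> 0" using K_pos lam p0 by (auto simp: K_def s_def)
  obtain g where g: "sl_solution p q (complex_of_real lam) ?f g" "asym ?f g K 0"
    using jost_bv_spec[of 1] by (auto simp: K_def)
  obtain e where e: "sl_solution p q (complex_of_real lam) ?h e" "asym ?h e 0 K"
    using jost_bv_spec[of "-1"] by (auto simp: K_def)
  obtain G where G: "sl_solution p q (complex_of_real lam) ?\<phi> G" "?\<phi> 0 = 0" "G 0 = complex_of_real (p 0)"
    by (rule regular_solution_spec)
  obtain a b where ab: "asym ?\<phi> G a b" using asym_exists[OF G(1)] by blast
  \<comment> \<open>As the regular solution vanishes at 0 with quasi-derivative \<open>p 0\<close>,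
    its Wronskian with a Jost solution is \<open>p 0\<close> times the value of the latter at 0.
    Each of the two Wronskians isolates one amplitude.\<close>
  have wp: "?w = - (2 * \<i> * s * b * K)"
    using asym_wronskian[OF G(1) g(1) ab g(2)] G by (simp add: wronsk_bv_def s_def)
  have wm: "cnj ?w = 2 * \<i> * s * a * K"
    using asym_wronskian[OF G(1) e(1) ab e(2)] G unfolding wronsk_cnj[symmetric]
    by (simp add: wronsk_bv_def s_def)
  have w: "?w = \<kappa> * cis \<eta>" using eta by (simp add: cis_conv_exp \<kappa>_def)
  have b: "b = - (\<kappa> * cis \<eta> / (2 * \<i> * s * K))"
    using wp pos unfolding w by (simp add: field_simps)
  have a: "a = \<kappa> * cis (- \<eta>) / (2 * \<i> * s * K)"
    using wm pos unfolding w by (simp add: field_simps cis_cnj)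
  have main: "a * cis (Phi x) + b * cis (- Phi x) = complex_of_real (\<kappa> / (s * K) * sin (Phi x - \<eta>))" for x
  proof -
    \<comment> \<open>The factor \<open>2 * \<i>\<close> in this formula cancels the one in the
      denominators of \<open>a\<close> and \<open>b\<close>.\<close>
    have sin: "cis t - cis (- t) = 2 * \<i> * sin t" for t by (simp add: complex_eq_iff)
    have "a * cis (Phi x) + b * cis (- Phi x) = \<kappa> / (2 * \<i> * s * K) * (cis (Phi x) * cis (- \<eta>) - cis \<eta> * cis (- Phi x))"
      unfolding a b by (simp add: right_diff_distrib mult_ac)
    also have "cis (Phi x) * cis (- \<eta>) - cis \<eta> * cis (- Phi x) = 2 * \<i> * sin (Phi x - \<eta>)"
      unfolding sin[symmetric] cis_mult by simp
    finally show ?thesis using pos by simp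
  qed
  show ?thesis
    using ab unfolding asym_def main \<kappa>_def K_def s_def by (auto elim: eventually_mono)
qed

end

section \<open>Absence of eigenvalues\<close>

lemma not_set_integrable_const_Ici:
  assumes "w > (0::real)"
  shows "\<not> set_integrable lborel {a..} (\<lambda>x::real. w)"
proof
  assume i: "set_integrable lborel {a..} (\<lambda>x::real. w)"
  have "ac_from a (\<lambda>x. w * (x - a)) (\<lambda>x. w)"
    by (rule ac_from_I[where c = 0, OF set_integrable_subset[OF i]]) (auto simp: set_lebesgue_integral_def)
  then obtain L where "((\<lambda>x. w * (x - a)) \<longlongrightarrow> L) at_top" using ac_from_limit i by blast
  moreover have "filterlim (\<lambda>x. w * (x - a)) at_top at_top"
  proof (rule filterlim_tendsto_pos_mult_at_top[OF tendsto_const assms])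
    show "filterlim (\<lambda>x. x - a) at_top at_top"
      using filterlim_tendsto_add_at_top[OF tendsto_const[of "-a"] filterlim_ident] by simp
  qed
  ultimately show False
    using not_tendsto_and_filterlim_at_infinity[OF trivial_limit_at_top_linorder _ filterlim_at_top_imp_at_infinity] by blast
qed

section \<open>Weak eigenfunctions solve the differential equation\<close>

context jost_setting
begin

context
  fixes f d :: "real \<Rightarrow> complex"
  assumes H: "H10_with_deriv f d"
    and weak: "\<And>g e. H10_with_deriv g e \<Longrightarrow>
        (LINT x:{0..}|lborel. complex_of_real (p x) * d x * cnj (e x) + complex_of_real (q x) * f x * cnj (g x))
        = complex_of_real lam * (LINT x:{0..}|lborel. f x * cnj (g x))"
begin

lemma H10_ac: "ac_from 0 f d"
  by (rule ac_from_I[where c = 0]) (use H in \<open>auto simp: H10_with_deriv_def\<close>)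

lemma H10_continuous: "0 \<le> a \<Longrightarrow> continuous_on {a..b} f"
  using ac_from_continuous[OF H10_ac] by (rule continuous_on_subset) auto

text \<open>The weak equation will identify \<open>p * d\<close> with this primitive up to a
  constant.\<close>

definition pot_int :: "real \<Rightarrow> complex" where
  "pot_int x = (LINT t:{0..x}|lborel. (complex_of_real (q t) - complex_of_real lam) * f t)"

lemma pot_int_ac: "ac_from 0 pot_int (\<lambda>t. (complex_of_real (q t) - complex_of_real lam) * f t)"
proof (rule ac_from_I[where c = 0])
  fix x :: real assume x: "0 \<le> x"
  show "set_integrable lborel {0..x} (\<lambda>t. (complex_of_real (q t) - complex_of_real lam) * f t)"
    by (intro set_integrable_mult_continuous set_integral_diff set_integrable_of_real q_int x H10_continuous
        borel_integrable_atLeastAtMost') auto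
qed (simp add: pot_int_def)

lemma pot_int_continuous: "0 \<le> a \<Longrightarrow> continuous_on {a..b} pot_int"
  using ac_from_continuous[OF pot_int_ac] by (rule continuous_on_subset) auto

text \<open>The weak equation says that \<open>p * d - pot_int\<close> has zero distributional
  derivative, once the term with \<open>q - lam\<close> is integrated by parts.\<close>

lemma weak_solution_locally:
  assumes X: "0 < X"
  shows "\<exists>\<mu>. AE x in lborel. x \<in> {0..X} \<longrightarrow> complex_of_real (p x) * d x - pot_int x = \<mu>"
proof -
  define h where "h x = complex_of_real (p x) * d x - pot_int x" for x
  have pc: "continuous_on {0..X} p" using p_cont by (rule continuous_on_subset) auto
  have ih: "set_integrable lborel {0..X} h"
    unfolding h_def
  proof (intro set_integral_diff(1))
    show "set_integrable lborel {0..X} (\<lambda>x. complex_of_real (p x) * d x)"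
      using set_integrable_mult_continuous[OF ac_from_integrable[OF H10_ac order_refl], of X "\<lambda>x. complex_of_real (p x)"]
        pc by (simp add: mult.commute)
    show "set_integrable lborel {0..X} pot_int"
      by (rule borel_integrable_atLeastAtMost') (rule pot_int_continuous, simp)
  qed
  \<comment> \<open>Subtracting the mean value of \<open>h\<close> makes the test function
    \<open>g\<close> return to zero at \<open>X\<close> and stay zero afterwards.\<close>
  define \<mu> where "\<mu> = (LINT x:{0..X}|lborel. h x) / complex_of_real X"
  \<comment> \<open>du Bois-Reymond: testing with the primitive of \<open>h - \<mu>\<close> gives that \<open>h - \<mu>\<close> has zero \<open>L\<^sup>2\<close> norm\<close>
  define e where "e x = indicator {0..X} x *\<^sub>R (h x - \<mu>)" for x
  define g where "g x = (LINT t:{0..x}|lborel. e t)" for x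
  have e_in: "e x = h x - \<mu>" if "x \<in> {0..X}" for x using that by (simp add: e_def)
  have e_out: "e x = 0" if "X < x" for x using that by (simp add: e_def)
  have ihm: "set_integrable lborel {0..X} (\<lambda>x. h x - \<mu>)"
    by (intro set_integral_diff ih borel_integrable_atLeastAtMost') auto
  then have ie: "integrable lborel e" by (simp add: e_def[abs_def] set_integrable_def)
  have ie': "set_integrable lborel A e" if "A \<in> sets lborel" for A
    using integrable_mult_indicator[OF that ie] by (simp add: set_integrable_def)
  have g_ac: "ac_from 0 g e"
    by (rule ac_from_I[where c = 0]) (auto simp: g_def ie')
  have g_out: "g x = 0" if "X \<le> x" for x
  proof -
    have "g x = (LINT t:{0..X}|lborel. h t - \<mu>)"
      unfolding g_def set_lebesgue_integral_def e_def
      by (intro Bochner_Integration.integral_cong) (use that in \<open>auto simp: indicator_def\<close>)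
    also have "\<dots> = (LINT t:{0..X}|lborel. h t) - (LINT t:{0..X}|lborel. \<mu>)"
      by (intro set_integral_diff ih borel_integrable_atLeastAtMost') auto
    also have "(LINT t:{0..X}|lborel. \<mu>) = complex_of_real X * \<mu>"
      using X by (simp add: set_lebesgue_integral_def scaleR_conv_of_real)
    finally show ?thesis using X by (simp add: \<mu>_def)
  qed
  have g_cont: "continuous_on {a..b} g" if "0 \<le> a" for a b
    using ac_from_continuous[OF g_ac] by (rule continuous_on_subset) (use that in auto)
  \<comment> \<open>\<open>d\<close> is square integrable, while \<open>p\<close> and
    \<open>pot_int\<close> are bounded on \<open>{0..X}\<close>. Hence \<open>g\<close> lies in the
    form domain.\<close>
  have e_sq: "set_integrable lborel {0..} (\<lambda>x. (cmod (e x))\<^sup>2)"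
  proof -
    have "bounded (p ` {0..X})" "bounded ((\<lambda>x. pot_int x + \<mu>) ` {0..X})"
      by (intro compact_imp_bounded compact_continuous_image pc continuous_intros pot_int_continuous; simp)+
    then obtain P Q where P: "\<And>x. x \<in> {0..X} \<Longrightarrow> \<bar>p x\<bar> \<le> P" and Q: "\<And>x. x \<in> {0..X} \<Longrightarrow> cmod (pot_int x + \<mu>) \<le> Q"
      unfolding bounded_iff ball_simps real_norm_def by blast
    have "set_integrable lborel {0..} (\<lambda>x. (cmod (d x))\<^sup>2)" using H by (simp add: H10_with_deriv_def)
    then have "set_integrable lborel {0..X} (\<lambda>x. (cmod (d x))\<^sup>2)" by (rule set_integrable_subset) auto
    moreover have "set_integrable lborel {0..X} (\<lambda>x. 2 * Q\<^sup>2)"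
      by (rule borel_integrable_atLeastAtMost') simp
    ultimately have "set_integrable lborel {0..X} (\<lambda>x. 2 * P\<^sup>2 * (cmod (d x))\<^sup>2 + 2 * Q\<^sup>2)"
      by (intro set_integral_add(1)) auto
    then have i: "integrable lborel (\<lambda>x. indicator {0..X} x *\<^sub>R (2 * P\<^sup>2 * (cmod (d x))\<^sup>2 + 2 * Q\<^sup>2))"
      by (simp add: set_integrable_def)
    have "integrable lborel (\<lambda>x. (cmod (e x))\<^sup>2)"
    proof (rule Bochner_Integration.integrable_bound[OF i])
      show "(\<lambda>x. (cmod (e x))\<^sup>2) \<in> borel_measurable lborel"
        using borel_measurable_integrable[OF ie] by measurable
      have "(cmod (e x))\<^sup>2 \<le> indicator {0..X} x *\<^sub>R (2 * P\<^sup>2 * (cmod (d x))\<^sup>2 + 2 * Q\<^sup>2)" for x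
      proof (cases "x \<in> {0..X}")
        case True
        have "cmod (e x) = cmod (complex_of_real (p x) * d x - (pot_int x + \<mu>))"
          using True by (simp add: e_in h_def algebra_simps)
        also have "\<dots> \<le> \<bar>p x\<bar> * cmod (d x) + cmod (pot_int x + \<mu>)"
          by (rule order_trans[OF norm_triangle_ineq4]) (simp add: norm_mult)
        also have "\<dots> \<le> P * cmod (d x) + Q"
          using P[OF True] Q[OF True] by (intro add_mono mult_right_mono) auto
        finally have "(cmod (e x))\<^sup>2 \<le> (P * cmod (d x) + Q)\<^sup>2" by (intro power_mono) auto
        also have "\<dots> \<le> 2 * (P * cmod (d x))\<^sup>2 + 2 * Q\<^sup>2"
          using zero_le_power2[of "P * cmod (d x) - Q"] unfolding power2_diff power2_sum by linarith
        finally show ?thesis using True by (simp add: power_mult_distrib)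
      qed (auto simp: e_def)
      then show "AE x in lborel. norm ((cmod (e x))\<^sup>2) \<le> norm (indicator {0..X} x *\<^sub>R (2 * P\<^sup>2 * (cmod (d x))\<^sup>2 + 2 * Q\<^sup>2))"
        by (intro AE_I2) (auto intro: order_trans)
    qed
    then show ?thesis
      using integrable_mult_indicator[of "{0..}" lborel "\<lambda>x. (cmod (e x))\<^sup>2"] by (simp add: set_integrable_def)
  qed
  have Hg: "H10_with_deriv g e"
    unfolding H10_with_deriv_def
  proof (intro conjI allI impI)
    show "g 0 = 0" using LINT_singleton[of 0 e] by (simp add: g_def)
    show "set_integrable lborel {0..x} e" for x by (rule ie') simp
    show "g x = (LINT t:{0..x}|lborel. e t)" for x by (simp add: g_def)
    show "set_borel_measurable lborel {0..} g"
      by (intro set_borel_measurable_Ici set_measurable_of_continuous g_cont) simp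
    show "set_borel_measurable lborel {0..} e"
      using ie'[of "{0..}"] by (auto simp: set_borel_measurable_def set_integrable_def)
    show "set_integrable lborel {0..} (\<lambda>x. (cmod (e x))\<^sup>2)" by (rule e_sq)
    have "set_integrable lborel {0..X} (\<lambda>x. (cmod (g x))\<^sup>2)"
      by (intro borel_integrable_atLeastAtMost' continuous_intros g_cont) simp
    moreover have "(\<lambda>x. indicator {0..X} x *\<^sub>R (cmod (g x))\<^sup>2) = (\<lambda>x. indicator {0..} x *\<^sub>R (cmod (g x))\<^sup>2)"
      using g_out by (auto simp: fun_eq_iff indicator_def)
    ultimately show "set_integrable lborel {0..} (\<lambda>x. (cmod (g x))\<^sup>2)" by (simp add: set_integrable_def)
  qed
  have restrict: "(LINT x:{0..}|lborel. F x) = (LINT x:{0..X}|lborel. F x)"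
    if "\<And>x. X < x \<Longrightarrow> F x = 0" for F :: "real \<Rightarrow> complex"
    unfolding set_lebesgue_integral_def
    by (intro Bochner_Integration.integral_cong refl) (use that in \<open>auto simp: indicator_def\<close>)
  have cg: "continuous_on {0..X} (\<lambda>x. cnj (g x))" by (intro continuous_intros g_cont) simp
  have ice: "set_integrable lborel {0..X} (\<lambda>x. cnj (e x))"
    by (rule ac_from_integrable[OF ac_from_cnj[OF g_ac] order_refl])
  have iGe: "set_integrable lborel {0..X} (\<lambda>x. pot_int x * cnj (e x))"
    using set_integrable_mult_continuous[OF ice pot_int_continuous] by (simp add: mult.commute)
  have isq: "set_integrable lborel {0..X} (\<lambda>x. e x * cnj (e x))"
  proof -
    have "set_integrable lborel {0..X} (\<lambda>x. (cmod (e x))\<^sup>2)" using e_sq by (rule set_integrable_subset) auto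
    then show ?thesis unfolding complex_norm_square[symmetric] by (rule set_integrable_of_real)
  qed
  have ihe: "set_integrable lborel {0..X} (\<lambda>x. e x * cnj (e x) + \<mu> * cnj (e x))"
    by (intro set_integral_add isq set_integrable_mult_right ice)
  have iqfg: "set_integrable lborel {0..X} (\<lambda>x. complex_of_real (q x) * f x * cnj (g x))"
    by (intro set_integrable_mult_continuous set_integrable_of_real q_int H10_continuous cg) (use X in auto)
  have ifg: "set_integrable lborel {0..X} (\<lambda>x. f x * cnj (g x))"
    by (intro borel_integrable_atLeastAtMost' continuous_intros H10_continuous g_cont) auto
  \<comment> \<open>On \<open>{0..X}\<close> this is just \<open>h = e + \<mu>\<close>, solved for
    \<open>p * d\<close>; the summand \<open>e * cnj e\<close> is the one to be isolated.\<close>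
  have pde: "complex_of_real (p x) * d x * cnj (e x) = e x * cnj (e x) + \<mu> * cnj (e x) + pot_int x * cnj (e x)"
    if "x \<in> {0..X}" for x
    unfolding distrib_right[symmetric] using that by (simp add: e_in h_def)
  define I1 I2 I3 I4 where "I1 = (LINT x:{0..X}|lborel. e x * cnj (e x) + \<mu> * cnj (e x))"
    and "I2 = (LINT x:{0..X}|lborel. pot_int x * cnj (e x))"
    and "I3 = (LINT x:{0..X}|lborel. complex_of_real (q x) * f x * cnj (g x))"
    and "I4 = (LINT x:{0..X}|lborel. f x * cnj (g x))"
  have "(LINT x:{0..}|lborel. complex_of_real (p x) * d x * cnj (e x) + complex_of_real (q x) * f x * cnj (g x))
      = (LINT x:{0..X}|lborel. complex_of_real (p x) * d x * cnj (e x) + complex_of_real (q x) * f x * cnj (g x))"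
    by (rule restrict) (simp add: e_out g_out)
  also have "\<dots> = (LINT x:{0..X}|lborel. ((e x * cnj (e x) + \<mu> * cnj (e x)) + pot_int x * cnj (e x))
        + complex_of_real (q x) * f x * cnj (g x))"
    by (rule set_lebesgue_integral_cong) (auto simp: pde)
  also have "\<dots> = I1 + I2 + I3"
    unfolding I1_def I2_def I3_def using set_integral_add[OF ihe iGe] iqfg by simp
  finally have e1: "I1 + I2 + I3 = complex_of_real lam * I4"
    using weak[OF Hg] restrict[of "\<lambda>x. f x * cnj (g x)"] g_out by (simp add: I4_def)
  \<comment> \<open>\<open>pot_int * cnj g\<close> vanishes at 0 and at \<open>X\<close>, so
    integration by parts gives \<open>I3 - lam * I4 + I2 = 0\<close>. Comparison with
    \<open>e1\<close> leaves \<open>I1 = 0\<close>.\<close>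
  have "ac_from 0 (\<lambda>x. pot_int x * cnj (g x)) (\<lambda>x. (complex_of_real (q x) - complex_of_real lam) * f x * cnj (g x) + pot_int x * cnj (e x))"
    by (rule ac_from_mult[OF pot_int_ac ac_from_cnj[OF g_ac]])
  from ac_from_diff[OF this order_refl, of X] X
  have "0 = (LINT x:{0..X}|lborel. (complex_of_real (q x) - complex_of_real lam) * f x * cnj (g x) + pot_int x * cnj (e x))"
    using g_out[of X] LINT_singleton[of 0 e] by (simp add: g_def)
  also have "\<dots> = (LINT x:{0..X}|lborel. (complex_of_real (q x) * f x * cnj (g x) - complex_of_real lam * (f x * cnj (g x))) + pot_int x * cnj (e x))"
    by (simp add: algebra_simps)
  also have "\<dots> = I3 - complex_of_real lam * I4 + I2"
    unfolding I2_def I3_def I4_def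
    using set_integral_add(2)[OF set_integral_diff(1)[OF iqfg set_integrable_mult_right[OF ifg, of "complex_of_real lam"]] iGe]
      set_integral_diff(2)[OF iqfg set_integrable_mult_right[OF ifg, of "complex_of_real lam"]] by simp
  finally have "I1 = 0" using e1 by (simp add: algebra_simps)
  \<comment> \<open>This integral is \<open>cnj (g X)\<close>, so the term with \<mu> drops out of
    \<open>I1\<close>.\<close>
  moreover have "(LINT x:{0..X}|lborel. cnj (e x)) = 0"
    using ac_from_diff[OF ac_from_cnj[OF g_ac] order_refl, of X] X g_out[of X] Hg
    by (simp add: H10_with_deriv_def)
  ultimately have "(LINT x:{0..X}|lborel. e x * cnj (e x)) = 0"
    using set_integral_add(2)[OF isq set_integrable_mult_right[OF ice, of \<mu>]] by (simp add: I1_def)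
  then have z: "(LINT x:{0..X}|lborel. (cmod (e x))\<^sup>2) = 0"
    unfolding complex_norm_square[symmetric] set_integral_complex_of_real by (simp del: of_real_power)
  have "set_integrable lborel {0..X} (\<lambda>x. (cmod (e x))\<^sup>2)" using e_sq by (rule set_integrable_subset) auto
  then have "AE x in lborel. indicator {0..X} x *\<^sub>R (cmod (e x))\<^sup>2 = 0"
    using z integral_nonneg_eq_0_iff_AE[of lborel "\<lambda>x. indicator {0..X} x *\<^sub>R (cmod (e x))\<^sup>2"]
    unfolding set_integrable_def set_lebesgue_integral_def by simp
  then have "AE x in lborel. x \<in> {0..X} \<longrightarrow> complex_of_real (p x) * d x - pot_int x = \<mu>"
    by eventually_elim (auto simp: e_in h_def)
  then show ?thesis by blast
qed

text \<open>The exceptional sets of countably many intervals are merged, after the constants have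
  been seen to agree.\<close>

lemma weak_solution_ae: "\<exists>\<mu>. AE x in lborel. 0 \<le> x \<longrightarrow> complex_of_real (p x) * d x - pot_int x = \<mu>"
proof -
  have "\<forall>n::nat. \<exists>\<mu>. AE x in lborel. x \<in> {0..real (Suc n)} \<longrightarrow> complex_of_real (p x) * d x - pot_int x = \<mu>"
    by (intro allI weak_solution_locally) simp
  then obtain \<mu> where \<mu>: "\<And>n. AE x in lborel. x \<in> {0..real (Suc n)} \<longrightarrow> complex_of_real (p x) * d x - pot_int x = \<mu> n"
    by metis
  have eq: "\<mu> n = \<mu> 0" for n
  proof (rule ccontr)
    assume ne: "\<mu> n \<noteq> \<mu> 0"
    \<comment> \<open>Owing to \<open>Suc n\<close> all intervals contain \<open>{0..1}\<close>, a
      set of positive measure on which two different constants cannot both hold almost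
      everywhere.\<close>
    have "AE x in lborel. x \<notin> {0..1::real}"
      using \<mu>[of n] \<mu>[of 0] by eventually_elim (use ne in auto)
    then have "emeasure lborel {0..1::real} = 0" by (intro AE_iff_measurable[THEN iffD1]) auto
    then show False by simp
  qed
  have "AE x in lborel. \<forall>n. x \<in> {0..real (Suc n)} \<longrightarrow> complex_of_real (p x) * d x - pot_int x = \<mu> n"
    using \<mu> by (simp add: AE_all_countable)
  then have "AE x in lborel. 0 \<le> x \<longrightarrow> complex_of_real (p x) * d x - pot_int x = \<mu> 0"
  proof eventually_elim
    case (elim x)
    obtain n where "x \<le> real n" using real_arch_simple by blast
    then show ?case using elim[rule_format, of n] eq[of n] by auto
  qed
  then show ?thesis by blast
qed

text \<open>\<open>\<mu> + pot_int\<close> is the continuous representative of \<open>p * d\<close>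
  and serves as quasi-derivative. The second conclusion is kept because it passes square
  integrability from \<open>d\<close> to \<open>g\<close>.\<close>

lemma weak_solution_ode:
  obtains g where "sl_solution p q (complex_of_real lam) f g"
    "AE x in lborel. 0 \<le> x \<longrightarrow> d x = g x / complex_of_real (p x)"
proof -
  obtain \<mu> where \<mu>: "AE x in lborel. 0 \<le> x \<longrightarrow> complex_of_real (p x) * d x - pot_int x = \<mu>"
    using weak_solution_ae by blast
  define g where "g x = \<mu> + pot_int x" for x
  have d: "AE x in lborel. 0 \<le> x \<longrightarrow> d x = g x / complex_of_real (p x)"
    using \<mu>
  proof eventually_elim
    case (elim x)
    show ?case
    proof
      assume x: "0 \<le> x"
      have "complex_of_real (p x) * d x = g x" using elim x by (auto simp: g_def algebra_simps)
      then show "d x = g x / complex_of_real (p x)" using p_pos[OF x] by (auto simp: field_simps)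
    qed
  qed
  have g: "ac_from 0 g (\<lambda>t. (complex_of_real (q t) - complex_of_real lam) * f t)"
    using ac_from_add[OF ac_from_const pot_int_ac, of \<mu>] by (simp add: g_def[abs_def])
  have "ac_from 0 f (\<lambda>t. g t / complex_of_real (p t))"
  proof (rule ac_from_I[where c = 0])
    fix x :: real assume x: "0 \<le> x"
    have "continuous_on {0..x} (\<lambda>t. g t / complex_of_real (p t))"
      using p_pos by (intro continuous_intros continuous_on_subset[OF p_cont]
          continuous_on_subset[OF ac_from_continuous[OF g]]) force+
    then show i: "set_integrable lborel {0..x} (\<lambda>t. g t / complex_of_real (p t))"
      by (rule borel_integrable_atLeastAtMost')
    have "(LINT t:{0..x}|lborel. d t) = (LINT t:{0..x}|lborel. g t / complex_of_real (p t))"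
      unfolding set_lebesgue_integral_def
    proof (rule integral_cong_AE)
      show "AE t in lborel. indicator {0..x} t *\<^sub>R d t = indicator {0..x} t *\<^sub>R (g t / complex_of_real (p t))"
        using d by eventually_elim (auto simp: indicator_def)
    qed (use i ac_from_integrable[OF H10_ac order_refl, of x] in \<open>auto simp: set_integrable_def\<close>)
    then show "f x = 0 + (LINT t:{0..x}|lborel. g t / complex_of_real (p t))"
      using H x by (simp add: H10_with_deriv_def)
  qed
  then show ?thesis using that[of g] g d by (simp add: sl_solution_def)
qed

text \<open>The estimate is made beyond \<open>x1\<close>, where \<open>solution_bounded\<close>
  controls the comparison solution and \<open>p \<le> 2 * p0\<close> bounds \<open>g\<close> by a
  multiple of \<open>d\<close>.\<close>

lemma weak_solution_eq_0: assumes "0 \<le> x" shows "f x = 0"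
proof -
  obtain g where sol: "sl_solution p q (complex_of_real lam) f g"
    and d: "AE x in lborel. 0 \<le> x \<longrightarrow> d x = g x / complex_of_real (p x)" by (rule weak_solution_ode)
  obtain x1 where "jost_tail p p' q q' p0 x0 lam x1" by (rule tail_exists)
  then interpret jost_tail p p' q q' p0 x0 lam x1 .
  show ?thesis
  proof (rule sl_solution_eq_0(1)[OF sol _ assms], rule ccontr)
    fix f2 g2 assume s2: "sl_solution p q (complex_of_real lam) f2 g2"
    let ?W = "g 0 * f2 0 - f 0 * g2 0"
    assume W: "?W \<noteq> 0"
    obtain M where M: "0 \<le> M" "\<And>x. x1 \<le> x \<Longrightarrow> cmod (f2 x) \<le> M" "\<And>x. x1 \<le> x \<Longrightarrow> cmod (g2 x) \<le> M"
      using solution_bounded[OF s2] by blast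
    \<comment> \<open>The Wronskian has modulus at most
      \<open>2 * p0 * M * cmod (d x) + M * cmod (f x)\<close>; squaring a sum costs a factor
      2.\<close>
    define V where "V = (\<lambda>x. 2 * (2 * p0 * M)\<^sup>2 * (cmod (d x))\<^sup>2 + 2 * M\<^sup>2 * (cmod (f x))\<^sup>2)"
    have "set_integrable lborel {0..} V"
      unfolding V_def by (intro set_integral_add set_integrable_mult_right)
        (use H in \<open>auto simp: H10_with_deriv_def\<close>)
    then have iV: "set_integrable lborel {x1..} V" by (rule set_integrable_subset) (use x1_nonneg in auto)
    have "set_integrable lborel {x1..} (\<lambda>x. (cmod ?W)\<^sup>2)"
      using iV
    proof (rule set_integrable_bound)
      show "set_borel_measurable lborel {x1..} (\<lambda>x. (cmod ?W)\<^sup>2)"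
        by (simp add: set_borel_measurable_def)
      show "AE x in lborel. x \<in> {x1..} \<longrightarrow> norm ((cmod ?W)\<^sup>2) \<le> norm (V x)"
        using d
      proof eventually_elim
        case (elim x)
        show ?case
        proof
          assume "x \<in> {x1..}"
          then have x: "x1 \<le> x" "0 \<le> x" using x1_nonneg by auto
          have px: "0 < p x" "p x \<le> 2 * p0" using tail_p[OF x(1)] p0 by auto
          have g: "g x = complex_of_real (p x) * d x" using elim x px by simp
          have "?W = g x * f2 x - f x * g2 x" using wronskian_const[OF sol s2 x(2)] by simp
          also have "cmod \<dots> \<le> cmod (g x) * cmod (f2 x) + cmod (f x) * cmod (g2 x)"
            by (metis norm_triangle_ineq4 norm_mult)
          also have "\<dots> \<le> (2 * p0 * cmod (d x)) * M + cmod (f x) * M"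
            using M x px unfolding g
            by (intro add_mono mult_mono) (auto simp: norm_mult intro!: mult_right_mono)
          finally have "(cmod ?W)\<^sup>2 \<le> (2 * p0 * M * cmod (d x) + M * cmod (f x))\<^sup>2"
            by (intro power_mono) (auto simp: algebra_simps)
          also have "\<dots> \<le> 2 * (2 * p0 * M * cmod (d x))\<^sup>2 + 2 * (M * cmod (f x))\<^sup>2"
            using zero_le_power2[of "2 * p0 * M * cmod (d x) - M * cmod (f x)"]
            unfolding power2_diff power2_sum by linarith
          also have "\<dots> = V x" by (simp add: V_def power_mult_distrib)
          finally show "norm ((cmod ?W)\<^sup>2) \<le> norm (V x)" by simp
        qed
      qed
    qed
    then show False using not_set_integrable_const_Ici[of "(cmod ?W)\<^sup>2"] W by simp
  qed
qed

end

lemma not_eigenvalue: "\<not> is_eigenvalue_H p q lam"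
  unfolding is_eigenvalue_H_def using weak_solution_eq_0 by blast

end

theorem theorem3p1:
  fixes p p' q q' :: "real \<Rightarrow> real" and p0 x0 :: real
  assumes "assumption_A p p' p0 q q' x0"
  shows "(\<forall>lam>0. wronsk_bv p p' q q' x0 1 lam \<noteq> 0 \<and> wronsk_bv p p' q q' x0 (-1) lam \<noteq> 0)
    \<and> (\<forall>eta. continuous_on {0<..} eta \<and>
          (\<forall>lam>0. wronsk_bv p p' q q' x0 1 lam
                   = complex_of_real (kappa_fun p p' q q' x0 lam) * exp (\<i> * complex_of_real (eta lam)))
        \<longrightarrow> (\<forall>lam>0. \<exists>C. \<forall>\<^sub>F x in at_top.
               cmod (regular_solution p q (complex_of_real lam) x
                 - complex_of_real (kappa_fun p p' q q' x0 lam / (sqrt (p0 * lam) * K_fun p q lam)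
                                    * sin (Phi_fun p q x lam - eta lam)))
               \<le> C * eps_fun p' q' x0 x))
    \<and> (\<forall>lam>0. \<not> is_eigenvalue_H p q lam)"
proof -
  have J: "jost_setting p p' q q' p0 x0 lam" if "lam > 0" for lam
    using assms that by unfold_locales
  show ?thesis
    using jost_setting.wronsk_nonzero[OF J] jost_setting.wronsk_cnj[OF J]
      jost_setting.regular_solution_asymptotics[OF J] jost_setting.not_eigenvalue[OF J]
    by auto
qed

end
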